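(* Let $t\in\mathbb{N}$, let $f:2^\Omega\to\mathbb{R}$ be a set function with $\Omega=\{1,\dots,n\}$, and let $F$ be its multilinear extension. Then $f$ is $t$-sos-submodular if and only if the polynomial $H_2(x,y):=F(y)-F(x)-\sum_{i=1}^n(y_i-x_i)\cdot\frac{\partial F(y)}{\partial x_i}$ is $(t+2)$-sos modulo $I_1[x,y]$.
   Context: $\mathbb{N}$ includes $0$. The multilinear extension (MLE) of a set function $f:2^\Omega\to\mathbb{R}$ is the unique multilinear polynomial $F\in\mathbb{R}[x_1,\dots,x_n]$ (every variable appears with power at most $1$ in every monomial) with $F(1_S)=f(S)$ for all $S\subseteq\Omega$, where $1_S\in\{0,1\}^n$ is the indicator vector of $S$. $\frac{\partial F(y)}{\partial x_i}$ denotes the partial derivative of $F$ with respect to its $i$-th argument, evaluated at $y$. For an ideal $I$ of a real polynomial ring, a polynomial $p$ is $t$-sos modulo $I$ if there are finitely many polynomials $q_1,\dots,q_m$ in that ring, each of degree at most $t$, with $p-\sum_{r=1}^m q_r^2\in I$. For $i\ne j$, $x_{-i,j}$ denotes the variables $x_1,\dots,x_n$ with $x_i,x_j$ removed, and $I_2[x_{-i,j}]=\langle x_k^2-x_k : k\neq i,j\rangle\subseteq\mathbb{R}[x_{-i,j}]$. The set function $f$ with MLE $F$ is $t$-sos-submodular if for all $i\neq j$ the polynomial $-\frac{\partial^2F(x)}{\partial x_i\partial x_j}$ (which does not involve $x_i,x_j$) is $t$-sos modulo $I_2[x_{-i,j}]$. With variables $x=(x_1,\dots,x_n)$, $y=(y_1,\dots,y_n)$,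 $I_1[x,y]=\langle\{x_i^2-x_i,\ x_iy_i-x_i,\ y_i^2-y_i\}_{i=1,\dots,n}\rangle\subseteq\mathbb{R}[x,y]$. *)

theory Defs
  imports Complex_Main "HOL-Library.Poly_Mapping" "HOL-Algebra.Ideal"
begin

section \<open>Real polynomials in several variables\<close>

text \<open>
  A polynomial maps finitely many monomials to nonzero coefficients, and a monomial maps finitely
  many variables to positive exponents.  Ring operations are those of \<^theory>\<open>HOL-Library.Poly_Mapping\<close>.
\<close>

type_synonym 'v mpoly = "('v \<Rightarrow>\<^sub>0 nat) \<Rightarrow>\<^sub>0 real"

definition Const :: "real \<Rightarrow> 'v mpoly" where
  "Const c = Poly_Mapping.single 0 c"

definition Var :: "'v \<Rightarrow> 'v mpoly" where
  "Var v = Poly_Mapping.single (Poly_Mapping.single v 1) 1"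

definition vars :: "'v mpoly \<Rightarrow> 'v set" where
  "vars p = (\<Union>m\<in>Poly_Mapping.keys p. Poly_Mapping.keys m)"

definition total_degree :: "'v mpoly \<Rightarrow> nat" where
  "total_degree p = Max (insert 0
     ((\<lambda>m. \<Sum>v\<in>Poly_Mapping.keys m. Poly_Mapping.lookup m v) ` Poly_Mapping.keys p))"

definition multilinear :: "'v mpoly \<Rightarrow> bool" where
  "multilinear p \<longleftrightarrow> (\<forall>m\<in>Poly_Mapping.keys p. \<forall>v. Poly_Mapping.lookup m v \<le> 1)"

text \<open>The value at \<open>g\<close>, with coefficients mapped by \<open>h\<close> into the target ring.\<close>

definition mpoly_hom :: "(real \<Rightarrow> 'a::comm_semiring_1) \<Rightarrow> ('v \<Rightarrow> 'a) \<Rightarrow> 'v mpoly \<Rightarrow> 'a" where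
  "mpoly_hom h g p = (\<Sum>m\<in>Poly_Mapping.keys p.
     h (Poly_Mapping.lookup p m) * (\<Prod>v\<in>Poly_Mapping.keys m. g v ^ Poly_Mapping.lookup m v))"

definition mpoly_eval :: "'v mpoly \<Rightarrow> ('v \<Rightarrow> real) \<Rightarrow> real" where
  "mpoly_eval p g = mpoly_hom (\<lambda>c. c) g p"

definition mpoly_subst :: "'v mpoly \<Rightarrow> ('v \<Rightarrow> 'w mpoly) \<Rightarrow> 'w mpoly" where
  "mpoly_subst p g = mpoly_hom Const g p"

text \<open>If \<open>v\<close> does not occur in \<open>m\<close>, the truncated exponent in the summand for \<open>m\<close> is harmless,
  since the coefficient is then \<open>0\<close>.\<close>

definition mpoly_deriv :: "'v \<Rightarrow> 'v mpoly \<Rightarrow> 'v mpoly" where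
  "mpoly_deriv v p = (\<Sum>m\<in>Poly_Mapping.keys p.
     Poly_Mapping.single (m - Poly_Mapping.single v 1)
       (real (Poly_Mapping.lookup m v) * Poly_Mapping.lookup p m))"

text \<open>The ring of real polynomials whose variables lie in \<open>V\<close>.\<close>

definition mpoly_ring :: "'v set \<Rightarrow> 'v mpoly ring" where
  "mpoly_ring V = \<lparr>carrier = {p. vars p \<subseteq> V}, mult = (*), one = 1, zero = 0, add = (+)\<rparr>"


section \<open>Sums of squares modulo an ideal\<close>

definition sos_mod :: "nat \<Rightarrow> 'v mpoly ring \<Rightarrow> 'v mpoly set \<Rightarrow> 'v mpoly \<Rightarrow> bool" where
  "sos_mod t R I p \<longleftrightarrow>
     (\<exists>(m::nat) q. (\<forall>r<m. q r \<in> carrier R \<and> total_degree (q r) \<le> t) \<and>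
                   p - (\<Sum>r<m. (q r)\<^sup>2) \<in> I)"


section \<open>Multilinear extensions and sos-submodularity\<close>

definition is_mle :: "nat \<Rightarrow> (nat set \<Rightarrow> real) \<Rightarrow> nat mpoly \<Rightarrow> bool" where
  "is_mle n f F \<longleftrightarrow> F \<in> carrier (mpoly_ring {1..n}) \<and> multilinear F \<and>
     (\<forall>S. S \<subseteq> {1..n} \<longrightarrow> mpoly_eval F (\<lambda>i. if i \<in> S then 1 else 0) = f S)"

text \<open>Existence and uniqueness are proved at the end of this theory.\<close>

definition mle :: "nat \<Rightarrow> (nat set \<Rightarrow> real) \<Rightarrow> nat mpoly" where
  "mle n f = (THE F. is_mle n f F)"

definition ideal2 :: "nat set \<Rightarrow> nat mpoly set" where
  "ideal2 V = Idl\<^bsub>mpoly_ring V\<^esub> {(Var k)\<^sup>2 - Var k | k. k \<in> V}"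

definition sos_submodular :: "nat \<Rightarrow> nat \<Rightarrow> (nat set \<Rightarrow> real) \<Rightarrow> bool" where
  "sos_submodular t n f \<longleftrightarrow>
     (\<forall>i\<in>{1..n}. \<forall>j\<in>{1..n}. i \<noteq> j \<longrightarrow>
        sos_mod t (mpoly_ring ({1..n} - {i, j})) (ideal2 ({1..n} - {i, j}))
          (- mpoly_deriv i (mpoly_deriv j (mle n f))))"


section \<open>The ring in the variables \<open>x\<close> and \<open>y\<close>\<close>

text \<open>The variable \<open>x\<^sub>i\<close> is indexed by \<open>Inl i\<close> and \<open>y\<^sub>i\<close> by \<open>Inr i\<close>.\<close>

definition x_var :: "nat \<Rightarrow> (nat + nat) mpoly" where
  "x_var i = Var (Inl i)"

definition y_var :: "nat \<Rightarrow> (nat + nat) mpoly" where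
  "y_var i = Var (Inr i)"

definition xy_ring :: "nat \<Rightarrow> (nat + nat) mpoly ring" where
  "xy_ring n = mpoly_ring ({1..n} <+> {1..n})"

definition ideal1 :: "nat \<Rightarrow> (nat + nat) mpoly set" where
  "ideal1 n = Idl\<^bsub>xy_ring n\<^esub>
     (\<Union>i\<in>{1..n}. {(x_var i)\<^sup>2 - x_var i, x_var i * y_var i - x_var i, (y_var i)\<^sup>2 - y_var i})"


section \<open>Well-definedness\<close>

lemma vars_add: "vars (p + q) \<subseteq> vars p \<union> vars q"
  using keys_add[of p q] unfolding vars_def by blast

lemma vars_uminus: "vars (- p) = vars p"
  unfolding vars_def by (simp add: Poly_Mapping.keys.rep_eq)

lemma vars_mult: "vars (p * q) \<subseteq> vars p \<union> vars q"
proof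
  fix v assume "v \<in> vars (p * q)"
  then obtain m where m: "m \<in> Poly_Mapping.keys (p * q)" "v \<in> Poly_Mapping.keys m"
    unfolding vars_def by blast
  from m(1) obtain a b where "m = a + b" "a \<in> Poly_Mapping.keys p" "b \<in> Poly_Mapping.keys q"
    using keys_mult[of p q] by blast
  then show "v \<in> vars p \<union> vars q"
    using m(2) keys_add[of a b] unfolding vars_def by blast
qed

lemma mpoly_ring_simps [simp]:
  "carrier (mpoly_ring V) = {p. vars p \<subseteq> V}" "mult (mpoly_ring V) = (*)"
  "one (mpoly_ring V) = 1" "zero (mpoly_ring V) = 0" "add (mpoly_ring V) = (+)"
  by (simp_all add: mpoly_ring_def)

lemma vars_0 [simp]: "vars 0 = {}" and vars_1 [simp]: "vars 1 = {}"
  by (simp_all add: vars_def)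

lemma cring_mpoly_ring: "cring (mpoly_ring V)"
proof (rule cringI)
  show "abelian_group (mpoly_ring V)"
  proof (rule abelian_groupI)
    fix p assume "p \<in> carrier (mpoly_ring V)"
    then show "\<exists>q\<in>carrier (mpoly_ring V). q \<oplus>\<^bsub>mpoly_ring V\<^esub> p = \<zero>\<^bsub>mpoly_ring V\<^esub>"
      by (intro bexI[of _ "- p"]) (simp_all add: vars_uminus)
  next
    fix p q assume "p \<in> carrier (mpoly_ring V)" "q \<in> carrier (mpoly_ring V)"
    then show "p \<oplus>\<^bsub>mpoly_ring V\<^esub> q \<in> carrier (mpoly_ring V)"
      using vars_add[of p q] by auto
  qed (simp_all add: add_ac)
  show "comm_monoid (mpoly_ring V)"
  proof (rule comm_monoidI)
    fix p q assume "p \<in> carrier (mpoly_ring V)" "q \<in> carrier (mpoly_ring V)"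
    then show "p \<otimes>\<^bsub>mpoly_ring V\<^esub> q \<in> carrier (mpoly_ring V)"
      using vars_mult[of p q] by auto
  qed (simp_all add: mult_ac)
qed (simp add: distrib_right)

lemma mpoly_eval_cong_keys:
  assumes "finite K" "Poly_Mapping.keys p \<subseteq> K"
  shows "mpoly_eval p g = (\<Sum>m\<in>K. Poly_Mapping.lookup p m *
           (\<Prod>v\<in>Poly_Mapping.keys m. g v ^ Poly_Mapping.lookup m v))"
  unfolding mpoly_eval_def mpoly_hom_def
  by (rule sum.mono_neutral_left) (use assms in \<open>auto simp: in_keys_iff\<close>)

lemma mpoly_eval_add: "mpoly_eval (p + q) g = mpoly_eval p g + mpoly_eval q g"
proof -
  let ?K = "Poly_Mapping.keys p \<union> Poly_Mapping.keys q"
  have "Poly_Mapping.keys (p + q) \<subseteq> ?K" by (rule keys_add)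
  then show ?thesis
    by (simp add: mpoly_eval_cong_keys[of ?K] lookup_add distrib_right sum.distrib)
qed

lemma mpoly_eval_diff: "mpoly_eval (p - q) g = mpoly_eval p g - mpoly_eval q g"
  using mpoly_eval_add[of "p - q" q g] by simp

lemma prod_indicator:
  "(\<Prod>v\<in>Poly_Mapping.keys m. (if v \<in> S then 1 else 0 :: real) ^ Poly_Mapping.lookup m v)
     = (if Poly_Mapping.keys m \<subseteq> S then 1 else 0)"
proof (cases "Poly_Mapping.keys m \<subseteq> S")
  case True
  then show ?thesis by (auto intro!: prod.neutral)
next
  case False
  then obtain v where "v \<in> Poly_Mapping.keys m" "v \<notin> S" by blast
  then have "(\<Prod>v\<in>Poly_Mapping.keys m. (if v \<in> S then 1 else 0 :: real) ^ Poly_Mapping.lookup m v) = 0"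
    by (intro prod_zero bexI[of _ v]) (auto simp: in_keys_iff)
  then show ?thesis using False by simp
qed

lemma keys_add_nat: "Poly_Mapping.keys (a + b :: 'v \<Rightarrow>\<^sub>0 nat) = Poly_Mapping.keys a \<union> Poly_Mapping.keys b"
  by (auto simp: in_keys_iff lookup_add)

lemma mpoly_eval_indicator:
  "mpoly_eval p (\<lambda>i. if i \<in> S then 1 else 0)
     = (\<Sum>m\<in>Poly_Mapping.keys p. Poly_Mapping.lookup p m * (if Poly_Mapping.keys m \<subseteq> S then 1 else 0))"
  unfolding mpoly_eval_def mpoly_hom_def by (simp add: prod_indicator)

lemma multilinear_keys_inj:
  assumes "multilinear p" "m \<in> Poly_Mapping.keys p" "m' \<in> Poly_Mapping.keys p"
    "Poly_Mapping.keys m = Poly_Mapping.keys m'"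
  shows "m = m'"
proof (rule poly_mapping_eqI)
  fix v
  have "Poly_Mapping.lookup m v \<le> 1" "Poly_Mapping.lookup m' v \<le> 1"
    using assms unfolding multilinear_def by auto
  moreover have "Poly_Mapping.lookup m v = 0 \<longleftrightarrow> Poly_Mapping.lookup m' v = 0"
    using assms(4) by (metis in_keys_iff)
  ultimately show "Poly_Mapping.lookup m v = Poly_Mapping.lookup m' v" by linarith
qed

lemma multilinear_vanish:
  assumes "vars p \<subseteq> V" "multilinear p"
    "\<And>S. S \<subseteq> V \<Longrightarrow> mpoly_eval p (\<lambda>i. if i \<in> S then 1 else 0) = 0"
  shows "p = 0"
proof (rule ccontr)
  assume "p \<noteq> 0"
  then have ne: "Poly_Mapping.keys p \<noteq> {}" by simp
  define m where "m = arg_min_on (\<lambda>m. card (Poly_Mapping.keys m)) (Poly_Mapping.keys p)"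
  have m: "m \<in> Poly_Mapping.keys p"
    unfolding m_def by (rule arg_min_if_finite(1)[OF finite_keys ne])
  have min: "card (Poly_Mapping.keys m) \<le> card (Poly_Mapping.keys m')"
    if "m' \<in> Poly_Mapping.keys p" for m'
    unfolding m_def by (rule arg_min_least[OF finite_keys ne that])
  let ?S = "Poly_Mapping.keys m"
  have only: "m' = m" if "m' \<in> Poly_Mapping.keys p" "Poly_Mapping.keys m' \<subseteq> ?S" for m'
    using card_seteq[OF finite_keys that(2) min[OF that(1)]]
      multilinear_keys_inj[OF assms(2) that(1) m] by blast
  have "?S \<subseteq> V" using m assms(1) unfolding vars_def by blast
  then have "0 = mpoly_eval p (\<lambda>i. if i \<in> ?S then 1 else 0)" using assms(3) by simp
  also have "\<dots> = (\<Sum>m'\<in>{m}. Poly_Mapping.lookup p m' * (if Poly_Mapping.keys m' \<subseteq> ?S then 1 else 0))"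
    unfolding mpoly_eval_indicator
    by (rule sum.mono_neutral_right) (use m only in auto)
  finally show False using m by (simp add: in_keys_iff)
qed

lemma multilinear_add: "multilinear p \<Longrightarrow> multilinear q \<Longrightarrow> multilinear (p + q)"
  using keys_add[of p q] unfolding multilinear_def by blast

lemma multilinear_diff: "multilinear p \<Longrightarrow> multilinear q \<Longrightarrow> multilinear (p - q)"
  using multilinear_add[of p "- q"] unfolding multilinear_def
  by (simp add: Poly_Mapping.keys.rep_eq)

lemma Pow_sum_inverse_exists:
  assumes "finite V"
  shows "\<exists>c. \<forall>S. S \<subseteq> V \<longrightarrow> (\<Sum>T\<in>Pow S. c T) = (f S :: real)"
  using assms
proof (induction V arbitrary: f rule: finite_induct)
  case empty
  then show ?case by (auto intro!: exI[of _ f])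
next
  case (insert a V)
  obtain c0 where c0: "\<forall>S. S \<subseteq> V \<longrightarrow> (\<Sum>T\<in>Pow S. c0 T) = f S"
    using insert.IH by blast
  obtain c1 where c1: "\<forall>S. S \<subseteq> V \<longrightarrow> (\<Sum>T\<in>Pow S. c1 T) = f (insert a S) - f S"
    using insert.IH[of "\<lambda>S. f (insert a S) - f S"] by blast
  define c where "c T = (if a \<in> T then c1 (T - {a}) else c0 T)" for T
  have low: "(\<Sum>T\<in>Pow S. c T) = f S" if "S \<subseteq> V" for S
  proof -
    have "(\<Sum>T\<in>Pow S. c T) = (\<Sum>T\<in>Pow S. c0 T)"
      using that insert.hyps by (intro sum.cong) (auto simp: c_def)
    then show ?thesis using c0 that by simp
  qed
  have "(\<Sum>T\<in>Pow S. c T) = f S" if S: "S \<subseteq> insert a V" for S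
  proof (cases "a \<in> S")
    case False
    then show ?thesis using S low[of S] by blast
  next
    case True
    define R where "R = S - {a}"
    have R: "R \<subseteq> V" "a \<notin> R" "S = insert a R" using S True by (auto simp: R_def)
    have fin: "finite R" using R(1) insert.hyps(1) finite_subset by blast
    have inj: "inj_on (insert a) (Pow R)"
      using R(2) by (intro inj_onI) (metis PowD insert_ident subsetD)
    have "(\<Sum>T\<in>insert a ` Pow R. c T) = (\<Sum>T\<in>Pow R. c1 T)"
      unfolding sum.reindex[OF inj]
    proof (rule sum.cong)
      fix T assume "T \<in> Pow R"
      then have "insert a T - {a} = T" using R(2) by blast
      then show "(c \<circ> insert a) T = c1 T" by (simp add: c_def)
    qed simp
    then have "(\<Sum>T\<in>insert a ` Pow R. c T) = f S - f R" using c1 R by simp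
    moreover have "(\<Sum>T\<in>Pow S. c T) = (\<Sum>T\<in>Pow R. c T) + (\<Sum>T\<in>insert a ` Pow R. c T)"
      unfolding R(3) Pow_insert by (rule sum.union_disjoint) (use fin R(2) in auto)
    ultimately show ?thesis using low[OF R(1)] by simp
  qed
  then show ?case by blast
qed

lemma multilinear_exists:
  assumes "finite V"
  shows "\<exists>F. vars F \<subseteq> V \<and> multilinear F \<and>
     (\<forall>S. S \<subseteq> V \<longrightarrow> mpoly_eval F (\<lambda>i. if i \<in> S then 1 else 0) = f S)"
proof -
  obtain c where c: "\<And>S. S \<subseteq> V \<Longrightarrow> (\<Sum>T\<in>Pow S. c T) = f S"
    using Pow_sum_inverse_exists[OF assms, of f] by blast
  define mono :: "'a set \<Rightarrow> 'a \<Rightarrow>\<^sub>0 nat" where "mono T = (\<Sum>v\<in>T. Poly_Mapping.single v 1)" for T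
  have lookup_mono: "Poly_Mapping.lookup (mono T) v = (if v \<in> T then 1 else 0)"
    if "finite T" for T v
    using that by (simp add: mono_def lookup_sum lookup_single when_def)
  have keys_mono: "Poly_Mapping.keys (mono T) = T" if "finite T" for T
    using lookup_mono[OF that] by (auto simp: in_keys_iff split: if_splits)
  define F where "F = (\<Sum>T\<in>Pow V. Poly_Mapping.single (mono T) (c T))"
  have fin: "finite T" if "T \<in> Pow V" for T using that assms finite_subset by blast
  have keys_F: "Poly_Mapping.keys F \<subseteq> mono ` Pow V"
  proof -
    have "Poly_Mapping.keys (Poly_Mapping.single (mono T) (c T)) \<subseteq> {mono T}" for T by simp
    then show ?thesis
      unfolding F_def using keys_sum[of "\<lambda>T. Poly_Mapping.single (mono T) (c T)" "Pow V"] by blast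
  qed
  have "vars F \<subseteq> V"
  proof
    fix v assume "v \<in> vars F"
    then obtain m where m: "m \<in> Poly_Mapping.keys F" "v \<in> Poly_Mapping.keys m"
      unfolding vars_def by blast
    then obtain T where "m = mono T" "T \<in> Pow V" using keys_F by blast
    then show "v \<in> V" using m(2) keys_mono[OF fin] by auto
  qed
  moreover have "multilinear F"
    unfolding multilinear_def
  proof (intro ballI allI)
    fix m v assume "m \<in> Poly_Mapping.keys F"
    then obtain T where "m = mono T" "T \<in> Pow V" using keys_F by blast
    then show "Poly_Mapping.lookup m v \<le> 1" using lookup_mono[OF fin] by simp
  qed
  moreover have "mpoly_eval F (\<lambda>i. if i \<in> S then 1 else 0) = f S" if S: "S \<subseteq> V" for S
  proof -
    have sum: "mpoly_eval F g = (\<Sum>T\<in>Pow V. mpoly_eval (Poly_Mapping.single (mono T) (c T)) g)" for g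
      unfolding F_def
      by (rule sum_comp_morphism[unfolded o_def, symmetric])
         (simp add: mpoly_eval_def mpoly_hom_def, rule mpoly_eval_add)
    have "mpoly_eval F (\<lambda>i. if i \<in> S then 1 else 0)
        = (\<Sum>T\<in>Pow V. c T * (if T \<subseteq> S then 1 else 0))"
      unfolding sum
      by (rule sum.cong) (use fin in \<open>simp_all add: mpoly_eval_indicator keys_mono\<close>)
    also have "\<dots> = (\<Sum>T\<in>Pow S. c T)"
      by (rule sum.mono_neutral_cong_right) (use assms S in auto)
    finally show ?thesis using c S by simp
  qed
  ultimately show ?thesis by blast
qed

lemma ex1_mle: "\<exists>!F. is_mle n f F"
proof (rule ex_ex1I)
  show "\<exists>F. is_mle n f F"
    using multilinear_exists[of "{1..n}" f] unfolding is_mle_def by simp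
next
  fix F G assume "is_mle n f F" "is_mle n f G"
  moreover have "vars (F - G) \<subseteq> vars F \<union> vars G"
    using vars_add[of F "- G"] by (simp add: vars_uminus)
  ultimately have "F - G = 0"
    by (intro multilinear_vanish[of "F - G" "{1..n}"])
       (auto simp: is_mle_def mpoly_eval_diff intro: multilinear_diff)
  then show "F = G" by simp
qed

lemma is_mle_mle: "is_mle n f (mle n f)"
  unfolding mle_def by (rule theI'[OF ex1_mle])

end

theory Submission
  imports Defs
begin

text \<open>
  Both ideals consist exactly of the polynomials that vanish on a finite set of 0/1 points: all
  vertices of the cube for \<^const>\<open>ideal2\<close>, and the pairs \<open>(x, y)\<close> of vertices with \<open>x \<le> y\<close>
  for \<^const>\<open>ideal1\<close> (\<open>ideal2_iff\<close>, \<open>ideal1_iff\<close>).  Being a sum of squares modulo the ideal is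
  therefore an identity between values at these points, with a bound on the degrees of the
  polynomials that are squared (\<open>sos_mod_iff_sos_on_points\<close>), and everything reduces to identities
  between values.  Write \<open>F\<^sub>k\<close> and \<open>F\<^sub>k\<^sub>l\<close> for partial derivatives.  Since \<open>F\<close> is multilinear, \<open>F\<^sub>k\<close> is
  the difference of \<open>F\<close> between \<open>x\<^sub>k = 1\<close> and \<open>x\<^sub>k = 0\<close>.

  If \<open>f\<close> is sos-submodular, go from \<open>x\<close> to \<open>y\<close> by replacing one coordinate after the other, and let
  \<open>w\<^sup>l = (y\<^sub>1, \<dots>, y\<^sub>l, x\<^sub>l\<^sub>+\<^sub>1, \<dots>, x\<^sub>n)\<close>.  Telescoping \<open>F\<close>, and then each \<open>F\<^sub>k\<close>, along this path gives
  \<open>H\<^sub>2 = (\<Sum>k<l. (y\<^sub>k - x\<^sub>k) (y\<^sub>l - x\<^sub>l) (- F\<^sub>k\<^sub>l (w\<^sup>l)))\<close> (\<open>first_order_gap_expansion\<close>).  At the points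
  considered, \<open>y\<^sub>k - x\<^sub>k\<close> is 0 or 1, hence equal to its square, so a representation of \<open>- F\<^sub>k\<^sub>l\<close> as a sum of
  squares \<open>q\<^sup>2\<close> yields squares of \<open>(y\<^sub>k - x\<^sub>k) (y\<^sub>l - x\<^sub>l) q (w\<^sup>l)\<close>, whose degree is larger by at most 2.

  Conversely, put \<open>y = z\<close> and let \<open>x\<close> be \<open>z\<close> with \<open>z\<^sub>i\<close> and \<open>z\<^sub>j\<close> replaced by 0.  Then \<open>H\<^sub>2\<close> becomes
  \<open>- z\<^sub>i z\<^sub>j F\<^sub>i\<^sub>j (z)\<close> (\<open>first_order_gap_two_coordinates\<close>).  This vanishes wherever \<open>z\<^sub>i = 0\<close> or
  \<open>z\<^sub>j = 0\<close>, so every polynomial \<open>P\<close> in the sum of squares vanishes there too.  Hence the value of \<open>P\<close>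
  at \<open>z\<^sub>i = z\<^sub>j = 1\<close> is the value of its second difference in the directions \<open>i\<close> and \<open>j\<close>, and each
  difference lowers the degree by one.  This is what brings the degree from \<open>t + 2\<close> down to \<open>t\<close>.
\<close>

section \<open>Evaluation is a ring homomorphism\<close>

lemma mpoly_eval_single:
  "mpoly_eval (Poly_Mapping.single m c) g
     = c * (\<Prod>v\<in>Poly_Mapping.keys m. g v ^ Poly_Mapping.lookup m v)"
  unfolding mpoly_eval_def mpoly_hom_def by (cases "c = 0") auto

lemma mpoly_eval_Const [simp]: "mpoly_eval (Const c) g = c"
  by (simp add: Const_def mpoly_eval_single)

lemma mpoly_eval_Var [simp]: "mpoly_eval (Var v) g = g v"
  by (simp add: Var_def mpoly_eval_single)

lemma Const_0 [simp]: "Const 0 = 0" and Const_1 [simp]: "Const 1 = 1"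
  by (simp_all add: Const_def)

lemma Const_add: "Const (a + b) = Const a + Const b"
  and Const_mult: "Const (a * b) = Const a * Const b"
  by (simp_all add: Const_def single_add mult_single)

lemma mpoly_eval_0 [simp]: "mpoly_eval 0 g = 0"
  and mpoly_eval_1 [simp]: "mpoly_eval 1 g = 1"
  using mpoly_eval_Const[of 0 g] mpoly_eval_Const[of 1 g] by simp_all

lemma mpoly_eval_uminus: "mpoly_eval (- p) g = - mpoly_eval p g"
  using mpoly_eval_diff[of 0 p g] by simp

lemma mpoly_eval_sum: "mpoly_eval (\<Sum>i\<in>A. p i) g = (\<Sum>i\<in>A. mpoly_eval (p i) g)"
  by (induction A rule: infinite_finite_induct) (simp_all add: mpoly_eval_add)

lemma sum_singles: "p = (\<Sum>m\<in>Poly_Mapping.keys p. Poly_Mapping.single m (Poly_Mapping.lookup p m))"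
  by (rule poly_mapping_eqI) (auto simp: lookup_sum lookup_single when_def in_keys_iff)

lemma mpoly_eval_mult: "mpoly_eval (p * q) g = mpoly_eval p g * mpoly_eval q g"
proof -
  have mono: "(\<Prod>v\<in>Poly_Mapping.keys (a + b). g v ^ Poly_Mapping.lookup (a + b) v)
      = (\<Prod>v\<in>Poly_Mapping.keys a. g v ^ Poly_Mapping.lookup a v)
        * (\<Prod>v\<in>Poly_Mapping.keys b. g v ^ Poly_Mapping.lookup b v)" for a b
  proof -
    let ?K = "Poly_Mapping.keys a \<union> Poly_Mapping.keys b"
    have "(\<Prod>v\<in>Poly_Mapping.keys a. g v ^ Poly_Mapping.lookup a v)
        = (\<Prod>v\<in>?K. g v ^ Poly_Mapping.lookup a v)"
      and "(\<Prod>v\<in>Poly_Mapping.keys b. g v ^ Poly_Mapping.lookup b v)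
        = (\<Prod>v\<in>?K. g v ^ Poly_Mapping.lookup b v)"
      by (rule prod.mono_neutral_left; auto simp: in_keys_iff)+
    then show ?thesis
      by (simp add: keys_add_nat lookup_add power_add prod.distrib)
  qed
  have "p * q = (\<Sum>a\<in>Poly_Mapping.keys p. Poly_Mapping.single a (Poly_Mapping.lookup p a))
      * (\<Sum>b\<in>Poly_Mapping.keys q. Poly_Mapping.single b (Poly_Mapping.lookup q b))"
    by (metis sum_singles)
  also have "\<dots> = (\<Sum>a\<in>Poly_Mapping.keys p. \<Sum>b\<in>Poly_Mapping.keys q.
      Poly_Mapping.single (a + b) (Poly_Mapping.lookup p a * Poly_Mapping.lookup q b))"
    by (simp add: sum_product mult_single)
  finally have "mpoly_eval (p * q) g = (\<Sum>a\<in>Poly_Mapping.keys p. \<Sum>b\<in>Poly_Mapping.keys q.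
      mpoly_eval (Poly_Mapping.single (a + b) (Poly_Mapping.lookup p a * Poly_Mapping.lookup q b)) g)"
    by (simp add: mpoly_eval_sum)
  also have "\<dots> = mpoly_eval p g * mpoly_eval q g"
    unfolding mpoly_eval_single mono unfolding mpoly_eval_def mpoly_hom_def sum_product
    by (simp add: mult_ac)
  finally show ?thesis .
qed

lemma mpoly_eval_power: "mpoly_eval (p ^ k) g = mpoly_eval p g ^ k"
  by (induction k) (simp_all add: mpoly_eval_mult)

lemma mpoly_eval_prod: "mpoly_eval (\<Prod>i\<in>A. p i) g = (\<Prod>i\<in>A. mpoly_eval (p i) g)"
  by (induction A rule: infinite_finite_induct) (simp_all add: mpoly_eval_mult)

lemmas mpoly_eval_ring_hom = mpoly_eval_add mpoly_eval_diff mpoly_eval_uminus mpoly_eval_mult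
  mpoly_eval_power mpoly_eval_sum mpoly_eval_prod

lemma mpoly_eval_subst:
  "mpoly_eval (mpoly_subst p g) a = mpoly_eval p (\<lambda>v. mpoly_eval (g v) a)"
  unfolding mpoly_subst_def mpoly_hom_def
  by (simp add: mpoly_eval_ring_hom) (simp add: mpoly_eval_def mpoly_hom_def)

lemma mpoly_eval_cong:
  assumes "vars p \<subseteq> V" "\<And>v. v \<in> V \<Longrightarrow> g v = h v"
  shows "mpoly_eval p g = mpoly_eval p h"
proof -
  have "g v = h v" if "m \<in> Poly_Mapping.keys p" "v \<in> Poly_Mapping.keys m" for m v
    using that assms unfolding vars_def by blast
  then show ?thesis unfolding mpoly_eval_def mpoly_hom_def by simp
qed


section \<open>Variables and degrees\<close>

lemma vars_Const [simp]: "vars (Const c) = {}"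
  by (simp add: vars_def Const_def)

lemma vars_Var [simp]: "vars (Var v) = {v}"
  by (simp add: vars_def Var_def)

lemma vars_subset_add: "vars p \<subseteq> V \<Longrightarrow> vars q \<subseteq> V \<Longrightarrow> vars (p + q) \<subseteq> V"
  and vars_subset_mult: "vars p \<subseteq> V \<Longrightarrow> vars q \<subseteq> V \<Longrightarrow> vars (p * q) \<subseteq> V"
  and vars_subset_diff: "vars p \<subseteq> V \<Longrightarrow> vars q \<subseteq> V \<Longrightarrow> vars (p - q) \<subseteq> V"
  using vars_add[of p q] vars_mult[of p q] vars_add[of p "- q"] by (auto simp: vars_uminus)

lemma vars_subset_power: "vars p \<subseteq> V \<Longrightarrow> vars (p ^ k) \<subseteq> V"
  by (induction k) (simp_all add: vars_subset_mult)

lemma vars_subset_sum: "(\<And>i. i \<in> A \<Longrightarrow> vars (p i) \<subseteq> V) \<Longrightarrow> vars (\<Sum>i\<in>A. p i) \<subseteq> V"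
  by (induction A rule: infinite_finite_induct) (simp_all add: vars_subset_add)

lemma vars_subset_prod: "(\<And>i. i \<in> A \<Longrightarrow> vars (p i) \<subseteq> V) \<Longrightarrow> vars (\<Prod>i\<in>A. p i) \<subseteq> V"
  by (induction A rule: infinite_finite_induct) (simp_all add: vars_subset_mult)

lemmas vars_subset_intros = vars_subset_add vars_subset_mult vars_subset_diff vars_subset_power
  vars_subset_sum vars_subset_prod

lemma vars_subst_subset:
  assumes "vars p \<subseteq> V" "\<And>v. v \<in> V \<Longrightarrow> vars (g v) \<subseteq> W"
  shows "vars (mpoly_subst p g) \<subseteq> W"
proof -
  have "vars (g v) \<subseteq> W" if "m \<in> Poly_Mapping.keys p" "v \<in> Poly_Mapping.keys m" for m v
    using that assms unfolding vars_def by blast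
  then show ?thesis
    unfolding mpoly_subst_def mpoly_hom_def by (intro vars_subset_intros) simp_all
qed

definition monomial_degree :: "('v \<Rightarrow>\<^sub>0 nat) \<Rightarrow> nat" where
  "monomial_degree m = (\<Sum>v\<in>Poly_Mapping.keys m. Poly_Mapping.lookup m v)"

lemma total_degree_le_iff:
  "total_degree p \<le> d \<longleftrightarrow> (\<forall>m\<in>Poly_Mapping.keys p. monomial_degree m \<le> d)"
  unfolding total_degree_def monomial_degree_def by (subst Max_le_iff) auto

lemma monomial_degree_add: "monomial_degree (a + b) = monomial_degree a + monomial_degree b"
proof -
  let ?K = "Poly_Mapping.keys a \<union> Poly_Mapping.keys b"
  have "monomial_degree a = (\<Sum>v\<in>?K. Poly_Mapping.lookup a v)"
    and "monomial_degree b = (\<Sum>v\<in>?K. Poly_Mapping.lookup b v)"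
    unfolding monomial_degree_def by (rule sum.mono_neutral_left; auto simp: in_keys_iff)+
  then show ?thesis
    by (simp add: monomial_degree_def keys_add_nat lookup_add sum.distrib)
qed

lemma total_degree_Const [simp]: "total_degree (Const c) = 0"
proof -
  have "total_degree (Const c) \<le> 0"
    unfolding total_degree_le_iff by (simp add: Const_def monomial_degree_def)
  then show ?thesis by simp
qed

lemma total_degree_0 [simp]: "total_degree 0 = 0" and total_degree_1 [simp]: "total_degree 1 = 0"
  using total_degree_Const[of 0] total_degree_Const[of 1] by simp_all

lemma total_degree_Var: "total_degree (Var v) \<le> 1"
  by (simp add: total_degree_le_iff Var_def monomial_degree_def)

lemma total_degree_add: "total_degree p \<le> d \<Longrightarrow> total_degree q \<le> d \<Longrightarrow> total_degree (p + q) \<le> d"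
  unfolding total_degree_le_iff using keys_add[of p q] by blast

lemma total_degree_diff: "total_degree p \<le> d \<Longrightarrow> total_degree q \<le> d \<Longrightarrow> total_degree (p - q) \<le> d"
  unfolding total_degree_le_iff using keys_diff[of p q] by blast

lemma total_degree_mult:
  assumes "total_degree p \<le> d" "total_degree q \<le> e"
  shows "total_degree (p * q) \<le> d + e"
  unfolding total_degree_le_iff
proof
  fix m assume "m \<in> Poly_Mapping.keys (p * q)"
  then obtain a b where "m = a + b" "a \<in> Poly_Mapping.keys p" "b \<in> Poly_Mapping.keys q"
    using keys_mult[of p q] by blast
  then show "monomial_degree m \<le> d + e"
    using assms by (auto simp: total_degree_le_iff monomial_degree_add add_mono)
qed

lemma total_degree_power:
  assumes "total_degree p \<le> d" shows "total_degree (p ^ k) \<le> k * d"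
  by (induction k) (use assms total_degree_mult[of p d] in auto)

lemma total_degree_sum:
  "(\<And>i. i \<in> A \<Longrightarrow> total_degree (p i) \<le> d) \<Longrightarrow> total_degree (\<Sum>i\<in>A. p i) \<le> d"
  by (induction A rule: infinite_finite_induct) (simp_all add: total_degree_add)

lemma total_degree_prod:
  "(\<And>i. i \<in> A \<Longrightarrow> total_degree (p i) \<le> d i) \<Longrightarrow> total_degree (\<Prod>i\<in>A. p i) \<le> (\<Sum>i\<in>A. d i)"
  by (induction A rule: infinite_finite_induct) (simp_all add: total_degree_mult)

lemma total_degree_subst_affine:
  assumes "total_degree p \<le> d" "\<And>v. total_degree (g v) \<le> 1"
  shows "total_degree (mpoly_subst p g) \<le> d"
  unfolding mpoly_subst_def mpoly_hom_def
proof (rule total_degree_sum)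
  fix m assume m: "m \<in> Poly_Mapping.keys p"
  have "total_degree (\<Prod>v\<in>Poly_Mapping.keys m. g v ^ Poly_Mapping.lookup m v) \<le> monomial_degree m"
    unfolding monomial_degree_def
    by (rule total_degree_prod) (use total_degree_power[OF assms(2)] in simp)
  also have "\<dots> \<le> d" using assms(1) m by (simp add: total_degree_le_iff)
  finally show "total_degree (Const (Poly_Mapping.lookup p m)
      * (\<Prod>v\<in>Poly_Mapping.keys m. g v ^ Poly_Mapping.lookup m v)) \<le> d"
    using total_degree_mult[of "Const (Poly_Mapping.lookup p m)" 0] by fastforce
qed


section \<open>Differences along a variable\<close>

text \<open>
  This is the polynomial \<open>p\<close> with \<open>x\<^sub>i = 1\<close> minus \<open>p\<close> with \<open>x\<^sub>i = 0\<close>: the monomials without \<open>x\<^sub>i\<close>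
  cancel, and the others lose their power of \<open>x\<^sub>i\<close>.
\<close>

definition mpoly_difference :: "'v \<Rightarrow> 'v mpoly \<Rightarrow> 'v mpoly" where
  "mpoly_difference i p = (\<Sum>m\<in>{m \<in> Poly_Mapping.keys p. Poly_Mapping.lookup m i > 0}.
     Poly_Mapping.single (m - Poly_Mapping.single i (Poly_Mapping.lookup m i))
       (Poly_Mapping.lookup p m))"

lemma lookup_drop:
  "Poly_Mapping.lookup (m - Poly_Mapping.single i (Poly_Mapping.lookup m i)) v
     = (if v = i then 0 else Poly_Mapping.lookup (m :: _ \<Rightarrow>\<^sub>0 nat) v)"
  by (simp add: lookup_minus lookup_single when_def)

lemma keys_drop:
  "Poly_Mapping.keys (m - Poly_Mapping.single i (Poly_Mapping.lookup m i))
     = Poly_Mapping.keys (m :: _ \<Rightarrow>\<^sub>0 nat) - {i}"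
proof -
  have "v \<in> Poly_Mapping.keys (m - Poly_Mapping.single i (Poly_Mapping.lookup m i))
      \<longleftrightarrow> v \<in> Poly_Mapping.keys m - {i}" for v
    unfolding Diff_iff in_keys_iff lookup_drop by simp
  then show ?thesis by blast
qed

lemma keys_mpoly_difference:
  assumes "k \<in> Poly_Mapping.keys (mpoly_difference i p)"
  obtains m where "m \<in> Poly_Mapping.keys p" "Poly_Mapping.lookup m i > 0"
    "k = m - Poly_Mapping.single i (Poly_Mapping.lookup m i)"
proof -
  from assms obtain m where
    "m \<in> Poly_Mapping.keys p" "Poly_Mapping.lookup m i > 0"
    "k \<in> Poly_Mapping.keys (Poly_Mapping.single
      (m - Poly_Mapping.single i (Poly_Mapping.lookup m i)) (Poly_Mapping.lookup p m))"
    unfolding mpoly_difference_def by (auto dest!: subsetD[OF keys_sum] split: if_splits)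
  then show thesis using that by (simp split: if_splits)
qed

lemma vars_mpoly_difference:
  assumes "vars p \<subseteq> V" shows "vars (mpoly_difference i p) \<subseteq> V - {i}"
proof
  fix v assume "v \<in> vars (mpoly_difference i p)"
  then obtain k where k: "k \<in> Poly_Mapping.keys (mpoly_difference i p)" "v \<in> Poly_Mapping.keys k"
    unfolding vars_def by blast
  then show "v \<in> V - {i}"
    using assms unfolding vars_def by (elim keys_mpoly_difference) (auto simp: keys_drop)
qed

text \<open>
  A monomial survives only if it contains \<open>x\<^sub>i\<close>, and it then loses all its factors \<open>x\<^sub>i\<close>.
\<close>

lemma total_degree_mpoly_difference:
  assumes "total_degree p \<le> Suc d" shows "total_degree (mpoly_difference i p) \<le> d"
  unfolding total_degree_le_iff
proof
  fix k assume "k \<in> Poly_Mapping.keys (mpoly_difference i p)"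
  then obtain m where m: "m \<in> Poly_Mapping.keys p" "Poly_Mapping.lookup m i > 0"
    and k: "k = m - Poly_Mapping.single i (Poly_Mapping.lookup m i)"
    by (rule keys_mpoly_difference)
  have "m = k + Poly_Mapping.single i (Poly_Mapping.lookup m i)"
    by (rule poly_mapping_eqI) (simp only: k lookup_add lookup_drop, simp add: lookup_single when_def)
  moreover have "monomial_degree (Poly_Mapping.single i (Poly_Mapping.lookup m i)) = Poly_Mapping.lookup m i"
    using m(2) by (simp add: monomial_degree_def)
  ultimately have "monomial_degree m = monomial_degree k + Poly_Mapping.lookup m i"
    by (metis monomial_degree_add)
  then show "monomial_degree k \<le> d"
    using assms m by (fastforce simp: total_degree_le_iff)
qed

lemma multilinear_mpoly_difference:
  assumes "multilinear p" shows "multilinear (mpoly_difference i p)"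
  unfolding multilinear_def
proof (intro ballI allI)
  fix k v assume "k \<in> Poly_Mapping.keys (mpoly_difference i p)"
  then obtain m where "m \<in> Poly_Mapping.keys p"
    "k = m - Poly_Mapping.single i (Poly_Mapping.lookup m i)"
    by (rule keys_mpoly_difference)
  then show "Poly_Mapping.lookup k v \<le> 1"
    using assms by (simp only: lookup_drop) (simp add: multilinear_def)
qed

lemma mpoly_eval_difference:
  "mpoly_eval (mpoly_difference i p) g = mpoly_eval p (g(i := 1)) - mpoly_eval p (g(i := 0))"
proof -
  let ?mono = "\<lambda>m g. \<Prod>v\<in>Poly_Mapping.keys m. g v ^ Poly_Mapping.lookup m v"
  let ?drop = "\<lambda>m. m - Poly_Mapping.single i (Poly_Mapping.lookup m i)"
  have mono: "?mono m (g(i := 1)) - ?mono m (g(i := 0))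
      = (if Poly_Mapping.lookup m i > 0 then ?mono (?drop m) g else 0)" for m :: "'a \<Rightarrow>\<^sub>0 nat"
  proof (cases "Poly_Mapping.lookup m i > 0")
    case False
    then have "i \<notin> Poly_Mapping.keys m" by (simp add: in_keys_iff)
    then have "?mono m (g(i := c)) = ?mono m g" for c
      by (intro prod.cong) auto
    then show ?thesis using False by simp
  next
    case True
    then have i: "i \<in> Poly_Mapping.keys m" by (simp add: in_keys_iff)
    have "?mono m (g(i := c)) = c ^ Poly_Mapping.lookup m i * ?mono (?drop m) g" for c
      unfolding prod.remove[OF finite_keys i] keys_drop
      by (simp only: lookup_drop) (auto intro!: prod.cong)
    then show ?thesis using True by simp
  qed
  have "mpoly_eval p (g(i := 1)) - mpoly_eval p (g(i := 0))
      = (\<Sum>m\<in>Poly_Mapping.keys p. Poly_Mapping.lookup p m * (?mono m (g(i := 1)) - ?mono m (g(i := 0))))"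
    unfolding mpoly_eval_def mpoly_hom_def by (simp add: sum_subtractf right_diff_distrib)
  also have "\<dots> = (\<Sum>m\<in>{m \<in> Poly_Mapping.keys p. Poly_Mapping.lookup m i > 0}.
      Poly_Mapping.lookup p m * ?mono (?drop m) g)"
    unfolding mono by (rule sum.mono_neutral_cong_right) auto
  also have "\<dots> = mpoly_eval (mpoly_difference i p) g"
    by (simp add: mpoly_difference_def mpoly_eval_sum mpoly_eval_single)
  finally show ?thesis by simp
qed

text \<open>
  On multilinear polynomials, derivatives are differences, so all that follows is about the latter.
\<close>

lemma mpoly_deriv_eq_difference:
  assumes "multilinear p" shows "mpoly_deriv i p = mpoly_difference i p"
  unfolding mpoly_deriv_def mpoly_difference_def
proof (rule sum.mono_neutral_cong_right)
  fix m assume "m \<in> {m \<in> Poly_Mapping.keys p. Poly_Mapping.lookup m i > 0}"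
  then have "Poly_Mapping.lookup m i > 0" "Poly_Mapping.lookup m i \<le> 1"
    using assms unfolding multilinear_def by auto
  then have "Poly_Mapping.lookup m i = 1" by linarith
  then show "Poly_Mapping.single (m - Poly_Mapping.single i 1)
        (real (Poly_Mapping.lookup m i) * Poly_Mapping.lookup p m)
      = Poly_Mapping.single (m - Poly_Mapping.single i (Poly_Mapping.lookup m i))
        (Poly_Mapping.lookup p m)"
    by simp
qed auto

text \<open>
  A multilinear polynomial is affine in each variable; the difference is its slope.
\<close>

lemma mpoly_eval_upd_multilinear:
  assumes "multilinear p"
  shows "mpoly_eval p (g(i := c)) = mpoly_eval p (g(i := 0)) + c * mpoly_eval (mpoly_difference i p) g"
proof -
  let ?mono = "\<lambda>m g. \<Prod>v\<in>Poly_Mapping.keys m. g v ^ Poly_Mapping.lookup m v"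
  have mono: "?mono m (g(i := c)) = (1 - c) * ?mono m (g(i := 0)) + c * ?mono m (g(i := 1))"
    if "m \<in> Poly_Mapping.keys p" for m
  proof (cases "i \<in> Poly_Mapping.keys m")
    case False
    then have "?mono m (g(i := c)) = ?mono m g" for c
      by (intro prod.cong) auto
    then show ?thesis by (simp add: algebra_simps)
  next
    case True
    have "Poly_Mapping.lookup m i \<noteq> 0" "Poly_Mapping.lookup m i \<le> 1"
      using True that assms by (auto simp: in_keys_iff multilinear_def)
    then have one: "Poly_Mapping.lookup m i = 1" by linarith
    have "?mono m (g(i := c)) = c * (\<Prod>v\<in>Poly_Mapping.keys m - {i}. g v ^ Poly_Mapping.lookup m v)" for c
      unfolding prod.remove[OF finite_keys True] one by (auto intro!: prod.cong)
    then show ?thesis by simp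
  qed
  have "mpoly_eval p (g(i := c)) = (1 - c) * mpoly_eval p (g(i := 0)) + c * mpoly_eval p (g(i := 1))"
    unfolding mpoly_eval_def mpoly_hom_def sum_distrib_left sum.distrib[symmetric]
  proof (rule sum.cong)
    fix m assume m: "m \<in> Poly_Mapping.keys p"
    show "Poly_Mapping.lookup p m * ?mono m (g(i := c))
        = (1 - c) * (Poly_Mapping.lookup p m * ?mono m (g(i := 0)))
          + c * (Poly_Mapping.lookup p m * ?mono m (g(i := 1)))"
      unfolding mono[OF m] by (simp only: distrib_left mult_ac)
  qed simp
  then show ?thesis by (simp add: mpoly_eval_difference algebra_simps)
qed

lemma mpoly_eval_difference_upd:
  "mpoly_eval (mpoly_difference i p) (g(i := c)) = mpoly_eval (mpoly_difference i p) g"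
  by (simp add: mpoly_eval_difference)


section \<open>Ideals of sets of 0/1 points\<close>

definition cube :: "('v \<Rightarrow> real) set" where
  "cube = {a. \<forall>v. a v \<in> {0, 1}}"

definition vertex :: "'v set \<Rightarrow> 'v \<Rightarrow> real" where
  "vertex S v = (if v \<in> S then 1 else 0)"

text \<open>
  On the vertices of the cube on \<open>V\<close>, this is the Lagrange basis polynomial of the vertex \<open>S\<close>.
\<close>

definition vertex_poly :: "'v set \<Rightarrow> 'v set \<Rightarrow> 'v mpoly" where
  "vertex_poly V S = (\<Prod>v\<in>S. Var v) * (\<Prod>v\<in>V - S. 1 - Var v)"

lemma mpoly_induct [consumes 1, case_names Const Var add mult]:
  fixes p :: "'v mpoly"
  assumes "vars p \<subseteq> V"
    and "\<And>c. P (Const c)" "\<And>v. v \<in> V \<Longrightarrow> P (Var v)"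
    and add: "\<And>p q. vars p \<subseteq> V \<Longrightarrow> vars q \<subseteq> V \<Longrightarrow> P p \<Longrightarrow> P q \<Longrightarrow> P (p + q)"
    and mult: "\<And>p q. vars p \<subseteq> V \<Longrightarrow> vars q \<subseteq> V \<Longrightarrow> P p \<Longrightarrow> P q \<Longrightarrow> P (p * q)"
  shows "P p"
proof -
  let ?Q = "\<lambda>p. vars p \<subseteq> V \<and> P p"
  have Const: "?Q (Const c)" for c using assms(2) by simp
  have zero: "?Q 0" and one: "?Q 1" using Const[of 0] Const[of 1] by simp_all
  have add': "?Q (p + q)" if "?Q p" "?Q q" for p q
    using that add vars_subset_add by blast
  have mult': "?Q (p * q)" if "?Q p" "?Q q" for p q
    using that mult vars_subset_mult by blast
  have power: "?Q (p ^ k)" if "?Q p" for p k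
    by (induction k) (use one mult' that in auto)
  have sum: "?Q (sum f A)" if "\<And>i. i \<in> A \<Longrightarrow> ?Q (f i)" for f and A :: "'c set"
    using that by (induction A rule: infinite_finite_induct) (use zero add' in auto)
  have prod: "?Q (prod f A)" if "\<And>i. i \<in> A \<Longrightarrow> ?Q (f i)" for f and A :: "'d set"
    using that by (induction A rule: infinite_finite_induct) (use one mult' in auto)
  have single: "Poly_Mapping.single m c
      = Const c * (\<Prod>v\<in>Poly_Mapping.keys m. Var v ^ Poly_Mapping.lookup m v)" for m :: "'v \<Rightarrow>\<^sub>0 nat" and c
  proof -
    have "Var v ^ k = Poly_Mapping.single (Poly_Mapping.single v k) (1 :: real)" for v :: 'v and k
      by (induction k) (simp_all add: Var_def mult_single single_add[symmetric])
    moreover have "(\<Prod>v\<in>A. Poly_Mapping.single (h v) (1::real)) = Poly_Mapping.single (sum h A) 1"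
      for A and h :: "'v \<Rightarrow> 'v \<Rightarrow>\<^sub>0 nat"
      by (induction A rule: infinite_finite_induct) (simp_all add: mult_single)
    ultimately show ?thesis
      by (simp add: Const_def mult_single sum_singles[of m, symmetric])
  qed
  have "?Q (Const (Poly_Mapping.lookup p m)
      * (\<Prod>v\<in>Poly_Mapping.keys m. Var v ^ Poly_Mapping.lookup m v))"
    if "m \<in> Poly_Mapping.keys p" for m
  proof (intro mult' prod power Const)
    fix v assume "v \<in> Poly_Mapping.keys m"
    then have "v \<in> V" using that assms(1) unfolding vars_def by blast
    then show "?Q (Var v)" using assms(3) by simp
  qed
  then have "?Q (\<Sum>m\<in>Poly_Mapping.keys p. Poly_Mapping.single m (Poly_Mapping.lookup p m))"
    by (intro sum) (simp add: single)
  then show ?thesis by (simp add: sum_singles[of p, symmetric])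
qed

lemma mpoly_ideal_closed:
  assumes "ideal I (mpoly_ring V)"
  shows "0 \<in> I" "p \<in> I \<Longrightarrow> q \<in> I \<Longrightarrow> p + q \<in> I"
    "vars r \<subseteq> V \<Longrightarrow> p \<in> I \<Longrightarrow> r * p \<in> I"
proof -
  interpret ideal I "mpoly_ring V" by (rule assms)
  show "0 \<in> I" using additive_subgroup.zero_closed[OF is_additive_subgroup] by simp
  show "p \<in> I \<Longrightarrow> q \<in> I \<Longrightarrow> p + q \<in> I" using additive_subgroup.a_closed[OF is_additive_subgroup] by simp
  show "vars r \<subseteq> V \<Longrightarrow> p \<in> I \<Longrightarrow> r * p \<in> I" using I_l_closed[of p r] by simp
qed

lemma mpoly_ideal_sum:
  assumes "ideal I (mpoly_ring V)" "\<And>i. i \<in> A \<Longrightarrow> p i \<in> I"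
  shows "(\<Sum>i\<in>A. p i) \<in> I"
  using assms(2) by (induction A rule: infinite_finite_induct)
    (simp_all add: mpoly_ideal_closed[OF assms(1)])

text \<open>
  If every variable acts on \<open>e\<close> modulo the ideal as a scalar, then so does every polynomial.  This is
  applied with the vertex polynomials as \<open>e\<close>.
\<close>

lemma eval_at_common_eigenvector:
  assumes I: "ideal I (mpoly_ring V)" and p: "vars p \<subseteq> V" and e: "vars e \<subseteq> V"
    and eig: "\<And>v. v \<in> V \<Longrightarrow> (Var v - Const (b v)) * e \<in> I"
  shows "(p - Const (mpoly_eval p b)) * e \<in> I"
  using p
proof (induction p rule: mpoly_induct)
  case (Const c)
  show ?case using mpoly_ideal_closed(1)[OF I] by simp
next
  case (Var v)
  then show ?case using eig by simp
next
  case (add p q)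
  have "(p + q - Const (mpoly_eval (p + q) b)) * e
      = (p - Const (mpoly_eval p b)) * e + (q - Const (mpoly_eval q b)) * e"
    by (simp add: mpoly_eval_add Const_add algebra_simps)
  then show ?case using add mpoly_ideal_closed(2)[OF I] by simp
next
  case (mult p q)
  have "(p * q - Const (mpoly_eval (p * q) b)) * e
      = q * ((p - Const (mpoly_eval p b)) * e)
        + Const (mpoly_eval p b) * ((q - Const (mpoly_eval q b)) * e)"
    by (simp add: mpoly_eval_mult Const_mult algebra_simps)
  then show ?case using mult mpoly_ideal_closed(2,3)[OF I] by simp
qed

lemma vars_vertex_poly: "S \<subseteq> V \<Longrightarrow> vars (vertex_poly V S) \<subseteq> V"
  unfolding vertex_poly_def by (intro vars_subset_intros) auto

text \<open>
  Expand the product of the factors \<open>x\<^sub>v + (1 - x\<^sub>v) = 1\<close>.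
\<close>

lemma sum_vertex_poly: "finite V \<Longrightarrow> (\<Sum>S\<in>Pow V. vertex_poly V S) = 1"
  unfolding vertex_poly_def by (subst prod_add[symmetric]) simp_all

text \<open>
  Lagrange interpolation: modulo the ideal, \<open>p\<close> is the sum over \<open>S\<close> of its value at the vertex \<open>S\<close> times
  the vertex polynomial of \<open>S\<close>.  Only vertices whose polynomial lies outside the ideal matter, which
  covers ideals with generators other than the \<open>x\<^sub>v\<^sup>2 - x\<^sub>v\<close>.
\<close>

lemma mem_ideal_if_vanishes_on_vertices:
  assumes I: "ideal I (mpoly_ring V)" and fin: "finite V"
    and sq: "\<And>v. v \<in> V \<Longrightarrow> (Var v)\<^sup>2 - Var v \<in> I"
    and p: "vars p \<subseteq> V"
    and vanish: "\<And>S. S \<subseteq> V \<Longrightarrow> vertex_poly V S \<notin> I \<Longrightarrow> mpoly_eval p (vertex S) = 0"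
  shows "p \<in> I"
proof -
  note closed = mpoly_ideal_closed[OF I]
  have "p * vertex_poly V S \<in> I" if S: "S \<subseteq> V" for S
  proof -
    have eig: "(Var v - Const (vertex S v)) * vertex_poly V S \<in> I" if v: "v \<in> V" for v
    proof (cases "v \<in> S")
      case True
      have "(\<Prod>v\<in>S. Var v) = Var v * (\<Prod>v\<in>S - {v}. Var v)"
        using fin S True finite_subset by (intro prod.remove) auto
      then have "(Var v - Const (vertex S v)) * vertex_poly V S
          = ((\<Prod>v\<in>S - {v}. Var v) * (\<Prod>v\<in>V - S. 1 - Var v)) * ((Var v)\<^sup>2 - Var v)"
        using True by (simp add: vertex_poly_def vertex_def algebra_simps power2_eq_square)
      also have "\<dots> \<in> I"
        by (intro closed(3) sq v vars_subset_intros) (use S in auto)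
      finally show ?thesis .
    next
      case False
      have "(\<Prod>v\<in>V - S. 1 - Var v) = (1 - Var v) * (\<Prod>v\<in>V - S - {v}. 1 - Var v)"
        using fin v False by (intro prod.remove) auto
      then have "(Var v - Const (vertex S v)) * vertex_poly V S
          = (Const (-1) * (\<Prod>v\<in>S. Var v) * (\<Prod>v\<in>V - S - {v}. 1 - Var v)) * ((Var v)\<^sup>2 - Var v)"
        using False unfolding vertex_poly_def
        by (simp only:) (simp add: vertex_def algebra_simps power2_eq_square Const_def single_uminus)
      also have "\<dots> \<in> I"
        by (intro closed(3) sq v vars_subset_intros) (use S in auto)
      finally show ?thesis .
    qed
    have "(p - Const (mpoly_eval p (vertex S))) * vertex_poly V S \<in> I"
      by (rule eval_at_common_eigenvector[OF I p vars_vertex_poly[OF S] eig])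
    moreover have "Const (mpoly_eval p (vertex S)) * vertex_poly V S \<in> I"
      using vanish[OF S] closed(1,3) by (cases "vertex_poly V S \<in> I") auto
    ultimately show ?thesis using closed(2) by (fastforce simp: algebra_simps)
  qed
  then have "(\<Sum>S\<in>Pow V. p * vertex_poly V S) \<in> I"
    by (intro mpoly_ideal_sum[OF I]) auto
  then show ?thesis
    by (simp add: sum_distrib_left[symmetric] sum_vertex_poly[OF fin])
qed

lemma vertex_in_cube: "vertex S \<in> cube"
  by (simp add: cube_def vertex_def)

lemma ideal_vanishing:
  "ideal {p. vars p \<subseteq> V \<and> (\<forall>a\<in>Z. mpoly_eval p a = 0)} (mpoly_ring V)"
  (is "ideal ?J _")
proof -
  interpret cring "mpoly_ring V" by (rule cring_mpoly_ring)
  have inv: "\<ominus>\<^bsub>mpoly_ring V\<^esub> p = - p" if "vars p \<subseteq> V" for p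
    using that by (intro minus_equality) (simp_all add: vars_uminus)
  show ?thesis
  proof (rule idealI)
    show "subgroup ?J (add_monoid (mpoly_ring V))"
    proof (rule add.subgroupI)
      show "?J \<noteq> {}" by (auto intro!: exI[of _ 0])
    qed (use inv in \<open>auto simp: vars_uminus vars_subset_add mpoly_eval_ring_hom a_inv_def\<close>)
  qed (auto simp: vars_subset_mult mpoly_eval_ring_hom ring_axioms dest: vars_subset_mult)
qed

lemma mem_genideal_imp_vanishes:
  assumes "p \<in> Idl\<^bsub>mpoly_ring V\<^esub> G"
    and "\<forall>g\<in>G. vars g \<subseteq> V" "\<forall>g\<in>G. \<forall>a\<in>Z. mpoly_eval g a = 0"
  shows "vars p \<subseteq> V \<and> (\<forall>a\<in>Z. mpoly_eval p a = 0)"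
proof -
  interpret cring "mpoly_ring V" by (rule cring_mpoly_ring)
  have "Idl\<^bsub>mpoly_ring V\<^esub> G \<subseteq> {p. vars p \<subseteq> V \<and> (\<forall>a\<in>Z. mpoly_eval p a = 0)}"
    by (rule genideal_minimal[OF ideal_vanishing]) (use assms(2,3) in blast)
  then show ?thesis using assms(1) by blast
qed

lemma ideal2_iff:
  assumes "finite V"
  shows "p \<in> ideal2 V \<longleftrightarrow> vars p \<subseteq> V \<and> (\<forall>a\<in>cube. mpoly_eval p a = 0)"
proof -
  interpret cring "mpoly_ring V" by (rule cring_mpoly_ring)
  let ?G = "{(Var k)\<^sup>2 - Var k | k. k \<in> V}"
  have G: "vars g \<subseteq> V" if g: "g \<in> ?G" for g
  proof -
    obtain k where "g = (Var k)\<^sup>2 - Var k" "k \<in> V" using g by blast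
    then show ?thesis by (simp add: vars_subset_diff vars_subset_power)
  qed
  have id: "ideal (ideal2 V) (mpoly_ring V)" and sub: "?G \<subseteq> ideal2 V"
    unfolding ideal2_def
    by (rule genideal_ideal genideal_self; use G in \<open>unfold mpoly_ring_simps, blast\<close>)+
  have vanish: "mpoly_eval g a = 0" if ga: "g \<in> ?G" "a \<in> cube" for g a
  proof -
    obtain k where "g = (Var k)\<^sup>2 - Var k" using ga(1) by blast
    moreover have "a k \<in> {0, 1}" using ga(2) by (simp add: cube_def)
    ultimately show ?thesis by (auto simp: mpoly_eval_ring_hom)
  qed
  show ?thesis
  proof
    assume "p \<in> ideal2 V"
    then show "vars p \<subseteq> V \<and> (\<forall>a\<in>cube. mpoly_eval p a = 0)"
      unfolding ideal2_def
      by (rule mem_genideal_imp_vanishes) ((intro ballI, erule G), (intro ballI, erule (1) vanish))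
  next
    assume p: "vars p \<subseteq> V \<and> (\<forall>a\<in>cube. mpoly_eval p a = 0)"
    show "p \<in> ideal2 V"
      by (rule mem_ideal_if_vanishes_on_vertices[OF id assms])
        (use p sub in \<open>auto simp: vertex_in_cube\<close>)
  qed
qed

text \<open>
  The value of \<open>x\<^sub>i y\<^sub>i - x\<^sub>i\<close> at a 0/1 point is zero exactly if \<open>x\<^sub>i \<le> y\<^sub>i\<close> there.
\<close>

definition nested_pairs :: "nat \<Rightarrow> (nat + nat \<Rightarrow> real) set" where
  "nested_pairs n = {a \<in> cube. \<forall>i\<in>{1..n}. a (Inl i) \<le> a (Inr i)}"

lemma ideal1_iff:
  "p \<in> ideal1 n \<longleftrightarrow>
     vars p \<subseteq> {1..n} <+> {1..n} \<and> (\<forall>a\<in>nested_pairs n. mpoly_eval p a = 0)"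
proof -
  let ?V = "{1..n} <+> {1..n}"
  let ?G = "\<Union>i\<in>{1..n}. {(x_var i)\<^sup>2 - x_var i, x_var i * y_var i - x_var i, (y_var i)\<^sup>2 - y_var i}"
  interpret cring "mpoly_ring ?V" by (rule cring_mpoly_ring)
  have G: "vars g \<subseteq> ?V" if g: "g \<in> ?G" for g
  proof -
    obtain i where i: "i \<in> {1..n}"
      "g \<in> {(x_var i)\<^sup>2 - x_var i, x_var i * y_var i - x_var i, (y_var i)\<^sup>2 - y_var i}"
      using g by blast
    then have "vars (x_var i) \<subseteq> ?V" "vars (y_var i) \<subseteq> ?V"
      by (simp_all add: x_var_def y_var_def InlI InrI)
    then show ?thesis
      using i(2) by (elim insertE emptyE)
        (simp_all add: vars_subset_diff vars_subset_power vars_subset_mult)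
  qed
  have id: "ideal (ideal1 n) (mpoly_ring ?V)" and sub: "?G \<subseteq> ideal1 n"
    unfolding ideal1_def xy_ring_def
    by (rule genideal_ideal genideal_self; use G in \<open>unfold mpoly_ring_simps, blast\<close>)+
  note closed = mpoly_ideal_closed[OF id]
  have gens: "(x_var i)\<^sup>2 - x_var i \<in> ideal1 n" "x_var i * y_var i - x_var i \<in> ideal1 n"
    "(y_var i)\<^sup>2 - y_var i \<in> ideal1 n" if "i \<in> {1..n}" for i
    using sub that by blast+
  show ?thesis
  proof
    assume p: "p \<in> ideal1 n"
    have vanish: "mpoly_eval g a = 0" if ga: "g \<in> ?G" "a \<in> nested_pairs n" for g a
    proof -
      obtain i where i: "i \<in> {1..n}"
        "g \<in> {(x_var i)\<^sup>2 - x_var i, x_var i * y_var i - x_var i, (y_var i)\<^sup>2 - y_var i}"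
        using ga(1) by blast
      have "a (Inl i) \<in> {0, 1}" "a (Inr i) \<in> {0, 1}" "a (Inl i) \<le> a (Inr i)"
        using ga(2) i(1) unfolding nested_pairs_def cube_def by blast+
      then show ?thesis
        using i(2) by (auto simp: mpoly_eval_ring_hom x_var_def y_var_def)
    qed
    from p show "vars p \<subseteq> ?V \<and> (\<forall>a\<in>nested_pairs n. mpoly_eval p a = 0)"
      unfolding ideal1_def xy_ring_def
      by (rule mem_genideal_imp_vanishes) ((intro ballI, erule G), (intro ballI, erule (1) vanish))
  next
    assume p: "vars p \<subseteq> ?V \<and> (\<forall>a\<in>nested_pairs n. mpoly_eval p a = 0)"
    show "p \<in> ideal1 n"
    proof (rule mem_ideal_if_vanishes_on_vertices[OF id])
      show "finite ?V" by simp
      show "vars p \<subseteq> ?V" using p by blast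
      show "(Var v)\<^sup>2 - Var v \<in> ideal1 n" if "v \<in> ?V" for v
        using that gens by (elim PlusE) (simp_all add: x_var_def y_var_def)
      fix S assume S: "S \<subseteq> ?V" and notin: "vertex_poly ?V S \<notin> ideal1 n"
      \<comment> \<open>A vertex with \<open>x\<^sub>i = 1\<close> and \<open>y\<^sub>i = 0\<close> has the factor \<open>x\<^sub>i (1 - y\<^sub>i)\<close> in its polynomial.\<close>
      have "Inr i \<in> S" if i: "i \<in> {1..n}" "Inl i \<in> S" for i
      proof (rule ccontr)
        assume "Inr i \<notin> S"
        then have r: "Inr i \<in> ?V - S" 
          using i(1) by (simp add: InrI)
        have "finite S" using S by (rule finite_subset) simp
        then have "vertex_poly ?V S
            = Const (-1) * (\<Prod>v\<in>S - {Inl i}. Var v) * (\<Prod>v\<in>?V - S - {Inr i}. 1 - Var v)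
              * (x_var i * y_var i - x_var i)"
          unfolding vertex_poly_def prod.remove[OF \<open>finite S\<close> i(2)] x_var_def y_var_def
          by (subst prod.remove[OF _ r]) (simp_all add: algebra_simps Const_def single_uminus)
        also have "\<dots> \<in> ideal1 n"
        proof (intro closed(3) vars_subset_intros)
          show "x_var i * y_var i - x_var i \<in> ideal1 n" using gens i(1) by simp
        qed (use S in auto)
        finally show False using notin by blast
      qed
      then have "vertex S \<in> nested_pairs n"
        using vertex_in_cube by (auto simp: nested_pairs_def vertex_def)
      then show "mpoly_eval p (vertex S) = 0" using p by blast
    qed
  qed
qed

lemma sos_mod_iff_sos_on_points:
  assumes I: "\<And>p. p \<in> I \<longleftrightarrow> vars p \<subseteq> V \<and> (\<forall>a\<in>Z. mpoly_eval p a = 0)"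
    and p: "vars p \<subseteq> V"
  shows "sos_mod t (mpoly_ring V) I p \<longleftrightarrow>
    (\<exists>(m::nat) q. (\<forall>r<m. vars (q r) \<subseteq> V \<and> total_degree (q r) \<le> t) \<and>
       (\<forall>a\<in>Z. mpoly_eval p a = (\<Sum>r<m. (mpoly_eval (q r) a)\<^sup>2)))"
proof -
  have "p - (\<Sum>r<m. (q r)\<^sup>2) \<in> I \<longleftrightarrow>
      (\<forall>a\<in>Z. mpoly_eval p a = (\<Sum>r<m. (mpoly_eval (q r) a)\<^sup>2))"
    if "\<forall>r<m. vars (q r) \<subseteq> V \<and> total_degree (q r) \<le> t" for m :: nat and q
  proof -
    have "vars (p - (\<Sum>r<m. (q r)\<^sup>2)) \<subseteq> V"
      using that p by (intro vars_subset_intros) auto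
    then show ?thesis by (simp add: I mpoly_eval_ring_hom)
  qed
  then show ?thesis
    unfolding sos_mod_def mpoly_ring_simps mem_Collect_eq by (intro ex_cong1 conj_cong refl) simp
qed


section \<open>Values of the first-order gap\<close>

text \<open>
  For \<open>l = 0, \<dots>, n\<close> these points form a path from \<open>x\<close> to \<open>y\<close> that changes one coordinate per step.
\<close>

definition hybrid :: "(nat \<Rightarrow> real) \<Rightarrow> (nat \<Rightarrow> real) \<Rightarrow> nat \<Rightarrow> nat \<Rightarrow> real" where
  "hybrid x y l i = (if i \<in> {1..l} then y i else x i)"

text \<open>
  The step from \<open>l - 1\<close> to \<open>l\<close> changes only coordinate \<open>l\<close>, in which \<open>p\<close> is affine.  Its slope does not
  depend on that coordinate, so it may be taken at the end of the step.
\<close>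

lemma eval_along_hybrids:
  fixes p :: "nat mpoly"
  assumes "multilinear p" "k \<le> m"
  shows "mpoly_eval p (hybrid x y m) - mpoly_eval p (hybrid x y k)
    = (\<Sum>l\<in>{k<..m}. (y l - x l) * mpoly_eval (mpoly_difference l p) (hybrid x y l))"
  using assms(2)
proof (induction m rule: dec_induct)
  case base
  then show ?case by simp
next
  case (step m)
  let ?l = "Suc m" and ?w = "hybrid x y"
  have upd: "?w ?l = (?w m)(?l := y ?l)" "(?w m)(?l := x ?l) = ?w m"
    by (auto simp: hybrid_def)
  have "mpoly_eval p (?w ?l) - mpoly_eval p (?w m)
      = (y ?l - x ?l) * mpoly_eval (mpoly_difference ?l p) (?w m)"
    using mpoly_eval_upd_multilinear[OF assms(1), of "?w m" ?l "y ?l"]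
      mpoly_eval_upd_multilinear[OF assms(1), of "?w m" ?l "x ?l"]
    unfolding upd by (simp add: algebra_simps)
  also have "mpoly_eval (mpoly_difference ?l p) (?w m) = mpoly_eval (mpoly_difference ?l p) (?w ?l)"
    unfolding upd(1) by (simp add: mpoly_eval_difference_upd)
  finally have "mpoly_eval p (?w ?l) - mpoly_eval p (?w m)
      = (y ?l - x ?l) * mpoly_eval (mpoly_difference ?l p) (?w ?l)" .
  moreover have "(\<Sum>l\<in>{k<..?l}. h l) = h ?l + (\<Sum>l\<in>{k<..m}. h l)" for h :: "nat \<Rightarrow> real"
  proof -
    have split: "{k<..?l} = insert ?l {k<..m}" using step.hyps by auto
    show ?thesis unfolding split by (rule sum.insert) simp_all
  qed
  note this[of "\<lambda>l. (y l - x l) * mpoly_eval (mpoly_difference l p) (?w l)"]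
  ultimately show ?case using step.IH by linarith
qed

text \<open>
  Telescoping \<open>p\<close> from \<open>x\<close> to \<open>y\<close> yields slopes at the points of the path; telescoping each slope over
  the rest of the path compares them with the slopes at \<open>y\<close>.
\<close>

lemma first_order_gap_expansion:
  fixes p :: "nat mpoly"
  assumes p: "multilinear p" "vars p \<subseteq> {1..n}"
  shows "mpoly_eval p y - mpoly_eval p x
      - (\<Sum>k = 1..n. (y k - x k) * mpoly_eval (mpoly_difference k p) y)
    = (\<Sum>k = 1..n. \<Sum>l\<in>{k<..n}. (y k - x k) * (y l - x l)
        * - mpoly_eval (mpoly_difference l (mpoly_difference k p)) (hybrid x y l))"
proof -
  let ?w = "hybrid x y"
  have w_n: "mpoly_eval q (?w n) = mpoly_eval q y" if "vars q \<subseteq> {1..n}" for q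
    by (rule mpoly_eval_cong[OF that]) (simp add: hybrid_def)
  have w_0: "?w 0 = x" by (simp add: hybrid_def fun_eq_iff)
  have "{0<..n} = {1..n}" by auto
  then have "mpoly_eval p y - mpoly_eval p x
      = (\<Sum>k = 1..n. (y k - x k) * mpoly_eval (mpoly_difference k p) (?w k))"
    using eval_along_hybrids[OF p(1), of 0 n x y] by (simp add: w_n p(2)[simplified] w_0)
  moreover have "(\<Sum>l\<in>{k<..n}. (y k - x k) * (y l - x l)
        * - mpoly_eval (mpoly_difference l (mpoly_difference k p)) (?w l))
      = (y k - x k) * mpoly_eval (mpoly_difference k p) (?w k)
        - (y k - x k) * mpoly_eval (mpoly_difference k p) y"
    if "k \<in> {1..n}" for k
  proof -
    have "k \<le> n" using that by simp
    have "vars (mpoly_difference k p) \<subseteq> {1..n}"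
      using vars_mpoly_difference[OF p(2)] by blast
    then have "mpoly_eval (mpoly_difference k p) y - mpoly_eval (mpoly_difference k p) (?w k)
        = (\<Sum>l\<in>{k<..n}. (y l - x l)
          * mpoly_eval (mpoly_difference l (mpoly_difference k p)) (?w l))"
      using eval_along_hybrids[OF multilinear_mpoly_difference[OF p(1)] \<open>k \<le> n\<close>, of k x y]
      unfolding w_n[OF \<open>vars (mpoly_difference k p) \<subseteq> {1..n}\<close>] by blast
    then have "(y k - x k) * (mpoly_eval (mpoly_difference k p) y - mpoly_eval (mpoly_difference k p) (?w k))
        = (\<Sum>l\<in>{k<..n}. (y k - x k) * ((y l - x l)
          * mpoly_eval (mpoly_difference l (mpoly_difference k p)) (?w l)))"
      by (simp only: sum_distrib_left)
    moreover have "(\<Sum>l\<in>{k<..n}. (y k - x k) * (y l - x l)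
        * - mpoly_eval (mpoly_difference l (mpoly_difference k p)) (?w l))
      = - (\<Sum>l\<in>{k<..n}. (y k - x k) * ((y l - x l)
          * mpoly_eval (mpoly_difference l (mpoly_difference k p)) (?w l)))"
      unfolding sum_negf[symmetric] by (rule sum.cong) simp_all
    ultimately show ?thesis by (simp only: right_diff_distrib minus_diff_eq)
  qed
  ultimately show ?thesis
    by (simp only: sum_subtractf cong: sum.cong)
qed

text \<open>
  As a function of \<open>z\<^sub>i\<close> and \<open>z\<^sub>j\<close> alone, \<open>p\<close> is \<open>a + b z\<^sub>i + c z\<^sub>j + d z\<^sub>i z\<^sub>j\<close>.  The tangent at \<open>z\<close> counts the
  mixed term twice, whereas the increment contains it once.
\<close>

lemma first_order_gap_two_coordinates:
  fixes p :: "nat mpoly" and z :: "nat \<Rightarrow> real"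
  assumes p: "multilinear p" and ij: "i \<in> {1..n}" "j \<in> {1..n}" "i \<noteq> j"
  defines "x \<equiv> z(i := 0, j := 0)"
  shows "mpoly_eval p z - mpoly_eval p x
      - (\<Sum>k = 1..n. (z k - x k) * mpoly_eval (mpoly_difference k p) z)
    = z i * z j * - mpoly_eval (mpoly_difference i (mpoly_difference j p)) z"
proof -
  have "(\<Sum>k = 1..n. (z k - x k) * mpoly_eval (mpoly_difference k p) z)
      = (\<Sum>k\<in>{i, j}. (z k - x k) * mpoly_eval (mpoly_difference k p) z)"
    by (rule sum.mono_neutral_right) (use ij in \<open>auto simp: x_def\<close>)
  also have "\<dots> = z i * mpoly_eval (mpoly_difference i p) z + z j * mpoly_eval (mpoly_difference j p) z"
    using ij(3) by (simp add: x_def)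
  finally have sum: "(\<Sum>k = 1..n. (z k - x k) * mpoly_eval (mpoly_difference k p) z)
      = z i * mpoly_eval (mpoly_difference i p) z + z j * mpoly_eval (mpoly_difference j p) z" .
  have "mpoly_eval p z = mpoly_eval p (z(i := 0)) + z i * mpoly_eval (mpoly_difference i p) z"
    using mpoly_eval_upd_multilinear[OF p, of z i "z i"] by simp
  moreover have "mpoly_eval p (z(i := 0))
      = mpoly_eval p x + z j * mpoly_eval (mpoly_difference j p) (z(i := 0))"
    using mpoly_eval_upd_multilinear[OF p, of "z(i := 0)" j "z j"] ij(3)
    by (simp add: x_def fun_upd_idem)
  moreover
  have "mpoly_eval (mpoly_difference j p) z = mpoly_eval (mpoly_difference j p) (z(i := 0))
      + z i * mpoly_eval (mpoly_difference i (mpoly_difference j p)) z"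
    using mpoly_eval_upd_multilinear[OF multilinear_mpoly_difference[OF p, of j], of z i "z i"] by simp
  then have "z j * mpoly_eval (mpoly_difference j p) z
      = z j * mpoly_eval (mpoly_difference j p) (z(i := 0))
        + z i * z j * mpoly_eval (mpoly_difference i (mpoly_difference j p)) z"
    by (simp only:) (simp only: distrib_left mult_ac)
  ultimately show ?thesis unfolding sum mult_minus_right by linarith
qed


section \<open>The equivalence\<close>

lemma sos_on_points_of_finite_family:
  fixes q :: "'b \<Rightarrow> 'v mpoly"
  assumes "finite A" "\<And>i. i \<in> A \<Longrightarrow> vars (q i) \<subseteq> V \<and> total_degree (q i) \<le> t"
    and "\<And>a. a \<in> Z \<Longrightarrow> h a = (\<Sum>i\<in>A. (mpoly_eval (q i) a)\<^sup>2)"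
  shows "\<exists>(m::nat) q. (\<forall>r<m. vars (q r) \<subseteq> V \<and> total_degree (q r) \<le> t) \<and>
       (\<forall>a\<in>Z. h a = (\<Sum>r<m. (mpoly_eval (q r) a)\<^sup>2))"
proof -
  obtain b where b: "bij_betw b {..<card A} A"
    using ex_bij_betw_nat_finite[OF assms(1)] by (auto simp: atLeast0LessThan)
  then have "b r \<in> A" if "r < card A" for r using that by (auto dest: bij_betwE)
  moreover have "(\<Sum>i\<in>A. (mpoly_eval (q i) a)\<^sup>2) = (\<Sum>r<card A. (mpoly_eval (q (b r)) a)\<^sup>2)" for a
    using sum.reindex_bij_betw[OF b, of "\<lambda>i. (mpoly_eval (q i) a)\<^sup>2"] by simp
  ultimately show ?thesis
    using assms(2,3) by (intro exI[of _ "card A"] exI[of _ "q \<circ> b"]) auto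
qed

text \<open>
  One square for each pair \<open>k < l\<close> and each square in the representation of the second difference at
  \<open>k\<close> and \<open>l\<close>, evaluated on the path from \<open>x\<close> to \<open>y\<close>.
\<close>

lemma sos_gap_of_sos_second_differences:
  fixes F :: "nat mpoly" and q :: "nat \<Rightarrow> nat \<Rightarrow> nat \<Rightarrow> nat mpoly" and m :: "nat \<Rightarrow> nat \<Rightarrow> nat"
  assumes F: "multilinear F" "vars F \<subseteq> {1..n}"
    and q: "\<And>k l r. k \<in> {1..n} \<Longrightarrow> l \<in> {k<..n} \<Longrightarrow> r < m k l \<Longrightarrow>
        vars (q k l r) \<subseteq> {1..n} \<and> total_degree (q k l r) \<le> t"
    and sos: "\<And>k l a. k \<in> {1..n} \<Longrightarrow> l \<in> {k<..n} \<Longrightarrow> a \<in> cube \<Longrightarrow>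
        - mpoly_eval (mpoly_difference l (mpoly_difference k F)) a
          = (\<Sum>r<m k l. (mpoly_eval (q k l r) a)\<^sup>2)"
  shows "\<exists>(M::nat) Q. (\<forall>r<M. vars (Q r) \<subseteq> {1..n} <+> {1..n} \<and> total_degree (Q r) \<le> t + 2) \<and>
    (\<forall>a\<in>nested_pairs n.
       mpoly_eval F (a \<circ> Inr) - mpoly_eval F (a \<circ> Inl)
         - (\<Sum>k = 1..n. (a (Inr k) - a (Inl k)) * mpoly_eval (mpoly_difference k F) (a \<circ> Inr))
       = (\<Sum>r<M. (mpoly_eval (Q r) a)\<^sup>2))"
proof -
  define A where "A = (SIGMA k:{1..n}. SIGMA l:{k<..n}. {..<m k l})"
  define path :: "nat \<Rightarrow> nat \<Rightarrow> (nat + nat) mpoly"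
    where "path l i = (if i \<in> {1..l} then y_var i else x_var i)" for l i
  define Q where "Q = (\<lambda>(k, l, r).
    (y_var k - x_var k) * (y_var l - x_var l) * mpoly_subst (q k l r) (path l))"
  show ?thesis
  proof (rule sos_on_points_of_finite_family[of A Q])
    show "finite A" unfolding A_def by auto
  next
    fix i assume "i \<in> A"
    then obtain k l r where i: "i = (k, l, r)" and k: "k \<in> {1..n}" and l: "l \<in> {k<..n}"
      and r: "r < m k l"
      unfolding A_def by auto
    have l': "l \<in> {1..n}" using k l by auto
    have "vars (path l v) \<subseteq> {1..n} <+> {1..n}" if "v \<in> {1..n}" for v
      using that by (auto simp: path_def x_var_def y_var_def)
    then have "vars (mpoly_subst (q k l r) (path l)) \<subseteq> {1..n} <+> {1..n}"
      using vars_subst_subset q[OF k l r] by blast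
    moreover have "vars (x_var v) \<subseteq> {1..n} <+> {1..n}" "vars (y_var v) \<subseteq> {1..n} <+> {1..n}"
      if "v \<in> {1..n}" for v
      using that by (auto simp: x_var_def y_var_def)
    ultimately have "vars (Q i) \<subseteq> {1..n} <+> {1..n}"
      unfolding Q_def i prod.case using k l' by (intro vars_subset_intros) blast+
    moreover have "total_degree (Q i) \<le> (1 + 1) + t"
      unfolding Q_def i prod.case path_def x_var_def y_var_def
      by (intro total_degree_mult total_degree_diff total_degree_Var total_degree_subst_affine)
        (use q[OF k l r] total_degree_Var in auto)
    ultimately show "vars (Q i) \<subseteq> {1..n} <+> {1..n} \<and> total_degree (Q i) \<le> t + 2" by simp
  next
    fix a assume a: "a \<in> nested_pairs n"
    define x y where "x = a \<circ> Inl" and "y = a \<circ> Inr"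
    let ?w = "hybrid x y"
    have w_cube: "?w l \<in> cube" for l
      using a by (auto simp: hybrid_def x_def y_def nested_pairs_def cube_def)
    have path: "(\<lambda>v. mpoly_eval (path l v) a) = ?w l" for l
      by (auto simp: path_def hybrid_def x_def y_def x_var_def y_var_def)
    \<comment> \<open>Nestedness excludes the value \<open>-1\<close>, which is not idempotent.\<close>
    have idem: "(y k - x k)\<^sup>2 = y k - x k" if "k \<in> {1..n}" for k
    proof -
      have "x k \<in> {0, 1}" "y k \<in> {0, 1}" "x k \<le> y k"
        using a that by (auto simp: x_def y_def nested_pairs_def cube_def)
      then show ?thesis by auto
    qed
    have "(y k - x k) * (y l - x l) * - mpoly_eval (mpoly_difference l (mpoly_difference k F)) (?w l)
        = (\<Sum>r<m k l. (mpoly_eval (Q (k, l, r)) a)\<^sup>2)" if k: "k \<in> {1..n}" and l: "l \<in> {k<..n}" for k l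
    proof -
      have "l \<in> {1..n}" using k l by auto
      have "mpoly_eval (Q (k, l, r)) a = (y k - x k) * (y l - x l) * mpoly_eval (q k l r) (?w l)" for r
        by (simp add: Q_def mpoly_eval_ring_hom mpoly_eval_subst path x_var_def y_var_def x_def y_def)
      then show ?thesis
        unfolding sos[OF k l w_cube]
        by (simp add: power_mult_distrib idem[OF k] idem[OF \<open>l \<in> {1..n}\<close>] sum_distrib_left)
    qed
    then have "mpoly_eval F y - mpoly_eval F x
         - (\<Sum>k = 1..n. (y k - x k) * mpoly_eval (mpoly_difference k F) y)
       = (\<Sum>k = 1..n. \<Sum>l\<in>{k<..n}. \<Sum>r<m k l. (mpoly_eval (Q (k, l, r)) a)\<^sup>2)"
      unfolding first_order_gap_expansion[OF F, of y x] by simp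
    also have "\<dots> = (\<Sum>i\<in>A. (mpoly_eval (Q i) a)\<^sup>2)"
      unfolding A_def by (simp add: sum.Sigma)
    finally show "mpoly_eval F (a \<circ> Inr) - mpoly_eval F (a \<circ> Inl)
         - (\<Sum>k = 1..n. (a (Inr k) - a (Inl k)) * mpoly_eval (mpoly_difference k F) (a \<circ> Inr))
       = (\<Sum>i\<in>A. (mpoly_eval (Q i) a)\<^sup>2)"
      by (simp add: x_def y_def)
  qed
qed

text \<open>
  The squares survive the substitution that makes \<open>x\<close> and \<open>y\<close> agree outside \<open>i\<close> and \<open>j\<close>.  A sum of
  squares vanishes only if each of its terms does, so the substituted polynomials can be replaced by
  their second differences, which have degree at most \<open>t\<close> and no longer contain \<open>x\<^sub>i\<close> and \<open>x\<^sub>j\<close>.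
\<close>

lemma sos_second_difference_of_sos_gap:
  fixes F :: "nat mpoly" and Q :: "nat \<Rightarrow> (nat + nat) mpoly" and M :: nat
  assumes F: "multilinear F"
    and ij: "i \<in> {1..n}" "j \<in> {1..n}" "i \<noteq> j"
    and Q: "\<And>r. r < M \<Longrightarrow> vars (Q r) \<subseteq> {1..n} <+> {1..n} \<and> total_degree (Q r) \<le> t + 2"
    and sos: "\<And>a. a \<in> nested_pairs n \<Longrightarrow>
       mpoly_eval F (a \<circ> Inr) - mpoly_eval F (a \<circ> Inl)
         - (\<Sum>k = 1..n. (a (Inr k) - a (Inl k)) * mpoly_eval (mpoly_difference k F) (a \<circ> Inr))
       = (\<Sum>r<M. (mpoly_eval (Q r) a)\<^sup>2)"
  shows "\<exists>q. (\<forall>r<M. vars (q r) \<subseteq> {1..n} - {i, j} \<and> total_degree (q r) \<le> t) \<and>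
    (\<forall>a\<in>cube. - mpoly_eval (mpoly_difference i (mpoly_difference j F)) a
       = (\<Sum>r<M. (mpoly_eval (q r) a)\<^sup>2))"
proof -
  define \<sigma> :: "nat + nat \<Rightarrow> nat mpoly" where
    "\<sigma> = case_sum (\<lambda>k. if k \<in> {i, j} then 0 else Var k) Var"
  define P where "P r = mpoly_subst (Q r) \<sigma>" for r
  define q where "q r = mpoly_difference j (mpoly_difference i (P r))" for r
  let ?G = "mpoly_difference i (mpoly_difference j F)"
  have P_sos: "z i * z j * - mpoly_eval ?G z = (\<Sum>r<M. (mpoly_eval (P r) z)\<^sup>2)" if z: "z \<in> cube" for z
  proof -
    let ?a = "case_sum (z(i := 0, j := 0)) z"
    have "?a v \<in> {0, 1}" for v using z by (cases v) (auto simp: cube_def)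
    moreover have "?a (Inl k) \<le> ?a (Inr k)" for k
    proof -
      have "z k \<in> {0, 1}" using z by (simp add: cube_def)
      then show ?thesis by auto
    qed
    ultimately have a: "?a \<in> nested_pairs n"
      unfolding nested_pairs_def cube_def by blast
    have "(\<lambda>v. mpoly_eval (\<sigma> v) z) = ?a"
      by (auto simp: \<sigma>_def fun_eq_iff split: sum.splits)
    then have "mpoly_eval (P r) z = mpoly_eval (Q r) ?a" for r
      by (simp add: P_def mpoly_eval_subst)
    moreover have "?a \<circ> Inl = z(i := 0, j := 0)" "?a \<circ> Inr = z" by auto
    ultimately show ?thesis
      using sos[OF a] first_order_gap_two_coordinates[OF F ij, of z] by simp
  qed
  have P_zero: "mpoly_eval (P r) z = 0" if "r < M" "z \<in> cube" "z i = 0 \<or> z j = 0" for r z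
  proof -
    have "(\<Sum>r<M. (mpoly_eval (P r) z)\<^sup>2) = 0" using P_sos[OF that(2)] that(3) by auto
    then show ?thesis using that(1) by (simp add: sum_nonneg_eq_0_iff)
  qed
  have "vars (q r) \<subseteq> {1..n} - {i, j} \<and> total_degree (q r) \<le> t" if "r < M" for r
  proof
    have "vars (\<sigma> v) \<subseteq> {1..n}" if "v \<in> {1..n} <+> {1..n}" for v
      using that by (auto simp: \<sigma>_def split: if_splits)
    then have "vars (P r) \<subseteq> {1..n}"
      unfolding P_def using vars_subst_subset Q[OF \<open>r < M\<close>] by blast
    then have "vars (q r) \<subseteq> {1..n} - {i} - {j}"
      unfolding q_def by (intro vars_mpoly_difference)
    then show "vars (q r) \<subseteq> {1..n} - {i, j}" by blast
    have "total_degree (\<sigma> v) \<le> 1" for v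
      using total_degree_Var by (auto simp: \<sigma>_def split: sum.splits)
    then have "total_degree (P r) \<le> Suc (Suc t)"
      unfolding P_def using total_degree_subst_affine Q[OF that] by fastforce
    then show "total_degree (q r) \<le> t"
      unfolding q_def by (intro total_degree_mpoly_difference)
  qed
  moreover have "- mpoly_eval ?G z = (\<Sum>r<M. (mpoly_eval (q r) z)\<^sup>2)" if z: "z \<in> cube" for z
  proof -
    let ?z = "z(i := 1, j := 1)"
    have upd: "z(i := b, j := c) \<in> cube" if "b \<in> {0, 1}" "c \<in> {0, 1}" for b c
      using z that by (auto simp: cube_def)
    \<comment> \<open>Of the four values in the second difference, only the one at \<open>z\<^sub>i = z\<^sub>j = 1\<close> can be nonzero.\<close>
    have "mpoly_eval (q r) z = mpoly_eval (P r) ?z" if "r < M" for r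
      using P_zero[OF that] upd ij(3)
      by (simp add: q_def mpoly_eval_difference fun_upd_twist[of j i])
    moreover have "mpoly_eval ?G z = mpoly_eval ?G ?z"
      using ij(3) by (simp add: mpoly_eval_difference fun_upd_twist[of j i])
    ultimately show ?thesis
      using P_sos[OF upd, of 1 1] ij(3) by simp
  qed
  ultimately show ?thesis by blast
qed

theorem theorem4:
  fixes t n :: nat and f :: "nat set \<Rightarrow> real" and F :: "nat mpoly"
    and H\<^sub>2 :: "(nat + nat) mpoly"
  assumes "F = mle n f"
    and "H\<^sub>2 = mpoly_subst F y_var - mpoly_subst F x_var
                 - (\<Sum>i = 1..n. (y_var i - x_var i) * mpoly_subst (mpoly_deriv i F) y_var)"
  shows "sos_submodular t n f \<longleftrightarrow> sos_mod (t + 2) (xy_ring n) (ideal1 n) H\<^sub>2"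
proof -
  let ?V = "\<lambda>i j. {1..n} - {i, j}"
  let ?D = "mpoly_difference"
  have F: "multilinear F" "vars F \<subseteq> {1..n}"
    using is_mle_mle[of n f] by (simp_all add: is_mle_def assms(1))
  have deriv: "mpoly_deriv i F = ?D i F" "mpoly_deriv i (?D j F) = ?D i (?D j F)" for i j
    by (simp_all add: mpoly_deriv_eq_difference multilinear_mpoly_difference F)
  have vars_D2: "vars (- ?D i (?D j F)) \<subseteq> ?V i j" for i j
    using vars_mpoly_difference[OF vars_mpoly_difference[OF F(2), of j], of i]
    by (auto simp: vars_uminus)
  have eval_H: "mpoly_eval H\<^sub>2 a = mpoly_eval F (a \<circ> Inr) - mpoly_eval F (a \<circ> Inl)
      - (\<Sum>k = 1..n. (a (Inr k) - a (Inl k)) * mpoly_eval (?D k F) (a \<circ> Inr))" for a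
    by (simp add: assms(2) deriv mpoly_eval_ring_hom mpoly_eval_subst x_var_def y_var_def comp_def)
  have vars_H: "vars H\<^sub>2 \<subseteq> {1..n} <+> {1..n}"
    unfolding assms(2) deriv x_var_def y_var_def
    by (intro vars_subset_intros vars_subst_subset[OF F(2)]
          vars_subst_subset[OF vars_mpoly_difference[OF F(2)]]) auto
  have submod: "sos_submodular t n f \<longleftrightarrow> (\<forall>i\<in>{1..n}. \<forall>j\<in>{1..n}. i \<noteq> j \<longrightarrow>
      (\<exists>(m::nat) q. (\<forall>r<m. vars (q r) \<subseteq> ?V i j \<and> total_degree (q r) \<le> t) \<and>
        (\<forall>a\<in>cube. - mpoly_eval (?D i (?D j F)) a = (\<Sum>r<m. (mpoly_eval (q r) a)\<^sup>2))))"
    unfolding sos_submodular_def assms(1)[symmetric] deriv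
    by (simp only: sos_mod_iff_sos_on_points[OF ideal2_iff vars_D2] finite_Diff finite_atLeastAtMost
        mpoly_eval_uminus)
  have gap: "sos_mod (t + 2) (xy_ring n) (ideal1 n) H\<^sub>2 \<longleftrightarrow>
      (\<exists>(M::nat) Q. (\<forall>r<M. vars (Q r) \<subseteq> {1..n} <+> {1..n} \<and> total_degree (Q r) \<le> t + 2) \<and>
        (\<forall>a\<in>nested_pairs n. mpoly_eval F (a \<circ> Inr) - mpoly_eval F (a \<circ> Inl)
           - (\<Sum>k = 1..n. (a (Inr k) - a (Inl k)) * mpoly_eval (?D k F) (a \<circ> Inr))
          = (\<Sum>r<M. (mpoly_eval (Q r) a)\<^sup>2)))"
    unfolding xy_ring_def sos_mod_iff_sos_on_points[OF ideal1_iff vars_H] eval_H ..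
  show ?thesis
  proof
    assume "sos_submodular t n f"
    define sos where "sos i j m q \<longleftrightarrow>
        (\<forall>r<m. vars (q r) \<subseteq> ?V i j \<and> total_degree (q r) \<le> t) \<and>
        (\<forall>a\<in>cube. - mpoly_eval (?D i (?D j F)) a = (\<Sum>r<m. (mpoly_eval (q r) a)\<^sup>2))"
      for i j m and q :: "nat \<Rightarrow> nat mpoly"
    have "\<forall>i\<in>{1..n}. \<forall>j\<in>{1..n}. i \<noteq> j \<longrightarrow> (\<exists>m q. sos i j m q)"
      using \<open>sos_submodular t n f\<close> unfolding submod sos_def .
    then obtain m q where mq: "\<And>i j. i \<in> {1..n} \<Longrightarrow> j \<in> {1..n} \<Longrightarrow> i \<noteq> j \<Longrightarrow> sos i j (m i j) (q i j)"
      by metis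
    have sos: "sos l k (m l k) (q l k)" if "k \<in> {1..n}" "l \<in> {k<..n}" for k l
      by (rule mq) (use that in auto)
    show "sos_mod (t + 2) (xy_ring n) (ideal1 n) H\<^sub>2"
      unfolding gap
    proof (rule sos_gap_of_sos_second_differences[OF F, of "\<lambda>k l. m l k" "\<lambda>k l. q l k"])
      fix k l r assume "k \<in> {1..n}" "l \<in> {k<..n}" "r < m l k"
      then show "vars (q l k r) \<subseteq> {1..n} \<and> total_degree (q l k r) \<le> t"
        using sos[of k l] unfolding sos_def by blast
    next
      fix k l a assume "k \<in> {1..n}" "l \<in> {k<..n}" "a \<in> (cube :: (nat \<Rightarrow> real) set)"
      then show "- mpoly_eval (?D l (?D k F)) a = (\<Sum>r<m l k. (mpoly_eval (q l k r) a)\<^sup>2)"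
        using sos[of k l] unfolding sos_def by blast
    qed
  next
    assume "sos_mod (t + 2) (xy_ring n) (ideal1 n) H\<^sub>2"
    then obtain M :: nat and Q where
      Q: "\<forall>r<M. vars (Q r) \<subseteq> {1..n} <+> {1..n} \<and> total_degree (Q r) \<le> t + 2" and
      sos: "\<forall>a\<in>nested_pairs n. mpoly_eval F (a \<circ> Inr) - mpoly_eval F (a \<circ> Inl)
          - (\<Sum>k = 1..n. (a (Inr k) - a (Inl k)) * mpoly_eval (?D k F) (a \<circ> Inr))
        = (\<Sum>r<M. (mpoly_eval (Q r) a)\<^sup>2)"
      unfolding gap by (elim exE conjE) (rule that)
    show "sos_submodular t n f"
      unfolding submod
    proof (intro ballI impI)
      fix i j assume ij: "i \<in> {1..n}" "j \<in> {1..n}" "i \<noteq> j"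
      show "\<exists>(m::nat) q. (\<forall>r<m. vars (q r) \<subseteq> ?V i j \<and> total_degree (q r) \<le> t) \<and>
        (\<forall>a\<in>cube. - mpoly_eval (?D i (?D j F)) a = (\<Sum>r<m. (mpoly_eval (q r) a)\<^sup>2))"
        by (rule exI[of _ M], rule sos_second_difference_of_sos_gap[OF F(1) ij
              Q[rule_format] sos[rule_format]])
    qed
  qed
qed

end
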